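(* (7-degree modular equation of Ramanujan's cubic continued fraction.) Let $q\in(0,1)$ and put $u=V(q)$ and $v=V(q^{7})$. Then $$u^8-uv+7u^4v+28u^6v^2-56u^5v^3+7uv^4+21u^4v^4-56u^7v^4-56u^3v^5+28u^2v^6-56u^4v^7-64u^7v^7+v^8=0.$$
   Context: For $0<q<1$, $V(q)=R(1,3,6;q)$ denotes Ramanujan's cubic continued fraction, $$V(q)=q^{1/3}\prod_{n=0}^{\infty}\frac{(1-q^{6n+1})(1-q^{6n+5})}{(1-q^{6n+3})^{2}}.$$ *)

theory Defs
  imports "HOL-Analysis.Analysis"
begin

text \<open>Ramanujan's cubic continued fraction, given by its product expansion; it is meant
  for \<open>0 < q < 1\<close>, where the infinite product converges to a nonzero value.\<close>

definition cubic_cf :: "real \<Rightarrow> real" where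
  "cubic_cf q = q powr (1/3) *
     (\<Prod>n. (1 - q ^ (6*n + 1)) * (1 - q ^ (6*n + 5)) / (1 - q ^ (6*n + 3))\<^sup>2)"

end

theory Submission
  imports Defs "HOL-Complex_Analysis.Complex_Analysis" "HOL-Probability.Probability"
begin

text \<open>
  Extended to the upper half plane by \<open>q = e\<^sup>2\<^sup>\<pi>\<^sup>i\<^sup>z\<close>, the continued fraction \<open>V\<close> satisfies
  \<open>V (z + 1) = \<omega> V z\<close> with \<open>\<omega>\<^sup>3 = 1\<close> and \<open>V (- 1 / (2 z)) = (1 - 2 V z) / (2 + 2 V z)\<close>. These two
  Moebius maps generate the tetrahedral group, and dividing the polynomial \<open>P (u, v)\<close> of the
  modular equation by \<open>g u * g v\<close>, where \<open>g u = u (1 + u\<^sup>3) (1 - 8 u\<^sup>3)\<close> is the form of degree 8 (with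
  a zero at infinity) vanishing at the vertices of two dual tetrahedra, makes it invariant
  under the diagonal action. The group generated by \<open>z \<mapsto> z + 1\<close> and \<open>z \<mapsto> - 1 / (2 z)\<close> permutes
  the values of \<open>F z = P (V z, V (7 z)) / (g (V z) * g (V (7 z)))\<close> at \<open>z\<close> and at the points
  \<open>(z + 3 j) / 7\<close>. As that group has a single cusp, at which \<open>F\<close> tends to 0 because
  \<open>V z ^ 7 / V (7 z)\<close> tends to 1, the modulus of \<open>F\<close> attains its maximum, so \<open>F\<close> is constant, hence 0.

  The inversion formula is proved on the imaginary axis, where it follows from Poisson summation for
  Gaussians, the triple product identity and 3-dissections of theta series.
\<close>

section \<open>The triple product identity\<close>

text \<open>\<open>F\<close> has no poles: \<open>V\<close> is finite and nonzero on the half plane,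
  so by the two Moebius maps it omits the tetrahedral orbits of 0 and infinity, and these are the
  eight zeros of \<open>g\<close>. Since \<open>P\<close>, like \<open>g\<close>, has degree 8 in
  each variable, the automorphy factors cancel in the quotient. The obstacle is that
  \<open>F\<close> itself is not visibly invariant under the inversion; only the set of its eight
  values is preserved. This is enough for the maximum principle, because every value of
  \<open>F\<close> then recurs at a point whose height is bounded below. The shifts are by multiples
  of 3 because \<open>V\<close> has period 3: \<open>V\<close> takes the value \<open>V z\<close> at
  7 times each point \<open>(z + 3 j) / 7\<close>, so all eight values are ratios formed with the
  same \<open>V z\<close>. That the inversion permutes the points with \<open>j\<close> nonzero, up
  to equality of \<open>V\<close>, rests on explicit substitutions fixing \<open>V\<close>, found as
  words in the two generators. At the cusp, \<open>u^8\<close>, \<open>u v\<close> and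
  \<open>g u * g v\<close> all have order \<open>q^(8/3)\<close>, so the coefficients 1 and -1 of
  the first two terms of \<open>P\<close> are what makes the limit 0.\<close>

fun qbinom :: "real \<Rightarrow> nat \<Rightarrow> nat \<Rightarrow> real" where
  "qbinom Q m 0 = 1"
| "qbinom Q 0 (Suc i) = 0"
| "qbinom Q (Suc m) (Suc i) = qbinom Q m i + Q ^ Suc i * qbinom Q m (Suc i)"

definition qpoch :: "real \<Rightarrow> nat \<Rightarrow> real" where
  "qpoch Q m = (\<Prod>k<m. 1 - Q ^ Suc k)"

lemma qbinom_eq_0: "i > m \<Longrightarrow> qbinom Q m i = 0"
  by (induction Q m i rule: qbinom.induct) auto

lemma qbinom_self [simp]: "qbinom Q m m = 1"
  by (induction m) (auto simp: qbinom_eq_0)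

text \<open>Closed form of the Gaussian binomial coefficient, multiplied out. The recursion gives
  nonnegativity directly; this form gives the bound and the limit in
  \<open>jacobi_triple_product\<close>.\<close>

lemma qbinom_qpoch: "qbinom Q (a + b) a * (qpoch Q a * qpoch Q b) = qpoch Q (a + b)"
proof (induction "a + b" arbitrary: a b)
  case 0
  thus ?case by (simp add: qpoch_def)
next
  case (Suc m a b)
  show ?case
  proof (cases "a = 0 \<or> b = 0")
    case True
    thus ?thesis by (auto simp: qpoch_def)
  next
    case False
    then obtain a' b' where ab: "a = Suc a'" "b = Suc b'"
      by (metis not0_implies_Suc)
    have Suc_qpoch: "qpoch Q (Suc k) = qpoch Q k * (1 - Q ^ Suc k)" for k
      by (simp add: qpoch_def)
    define n where "n = a' + b' + 1"
    have n: "a' + b = n" "a + b' = n" "a + b = Suc n"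
      using ab by (simp_all add: n_def)
    have "qbinom Q (a' + b) a' * (qpoch Q a' * qpoch Q b) = qpoch Q (a' + b)"
      by (rule Suc.hyps(1)) (use Suc.hyps(2) ab in simp)
    moreover have "qbinom Q (a + b') a * (qpoch Q a * qpoch Q b') = qpoch Q (a + b')"
      by (rule Suc.hyps(1)) (use Suc.hyps(2) ab in simp)
    ultimately have IH: "qbinom Q n a' * (qpoch Q a' * qpoch Q b) = qpoch Q n"
      "qbinom Q n a * (qpoch Q a * qpoch Q b') = qpoch Q n"
      unfolding n by simp_all
    \<comment> \<open>The q-Pascal rule with the last factor of \<open>qpoch Q a\<close> or of
      \<open>qpoch Q b\<close> split off; the parts recombine because
      \<open>(1 - Q ^ a) + Q ^ a * (1 - Q ^ b) = 1 - Q ^ (a + b)\<close>.\<close>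
    have "qbinom Q (a + b) a * (qpoch Q a * qpoch Q b)
        = (qbinom Q n a' * (qpoch Q a' * qpoch Q b)) * (1 - Q ^ a)
          + Q ^ a * (qbinom Q n a * (qpoch Q a * qpoch Q b')) * (1 - Q ^ b)"
      unfolding n unfolding ab by (simp add: Suc_qpoch algebra_simps)
    also have "\<dots> = qpoch Q n * (1 - Q ^ (a + b))"
      unfolding IH by (simp add: algebra_simps power_add)
    also have "\<dots> = qpoch Q (a + b)"
      unfolding n by (simp add: Suc_qpoch)
    finally show ?thesis .
  qed
qed

text \<open>Splitting off the factor with \<open>k = 0\<close> leaves the product for
  \<open>y * Q\<close>, which is why the induction is over all \<open>y\<close>; multiplying its
  expansion by \<open>1 + y\<close> reproduces the q-Pascal rule.\<close>

lemma q_binomial_theorem: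
  "(\<Prod>k<m. 1 + y * Q ^ k) = (\<Sum>i\<le>m. qbinom Q m i * Q ^ (i choose 2) * y ^ i)"
proof (induction m arbitrary: y)
  case (Suc m)
  have sc: "Suc i choose 2 = i + (i choose 2)" for i
    by (simp add: numeral_2_eq_2)
  have "(\<Prod>k<Suc m. 1 + y * Q ^ k) = (1 + y) * (\<Prod>k<m. 1 + (y * Q) * Q ^ k)"
    by (simp add: prod.lessThan_Suc_shift mult_ac del: prod.lessThan_Suc)
  also have "\<dots> = (1 + y) * (\<Sum>i\<le>m. qbinom Q m i * Q ^ (i choose 2) * (y * Q) ^ i)"
    by (simp only: Suc.IH)
  also have "\<dots> = (\<Sum>i\<le>m. qbinom Q m i * Q ^ (i choose 2) * (y * Q) ^ i)
      + (\<Sum>i\<le>m. qbinom Q m i * Q ^ (Suc i choose 2) * y ^ Suc i)"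
    by (simp add: algebra_simps sum_distrib_left sum.distrib sc power_add power_mult_distrib)
  also have "(\<Sum>i\<le>m. qbinom Q m i * Q ^ (i choose 2) * (y * Q) ^ i)
      = (\<Sum>i\<le>Suc m. qbinom Q m i * Q ^ (i choose 2) * (y * Q) ^ i)"
    by (simp add: qbinom_eq_0)
  also have "\<dots> = 1 + (\<Sum>i\<le>m. qbinom Q m (Suc i) * Q ^ (Suc i choose 2) * (y * Q) ^ Suc i)"
    by (subst sum.atMost_Suc_shift) (simp add: binomial_eq_0)
  also have "\<dots> + (\<Sum>i\<le>m. qbinom Q m i * Q ^ (Suc i choose 2) * y ^ Suc i)
      = 1 + (\<Sum>i\<le>m. qbinom Q (Suc m) (Suc i) * Q ^ (Suc i choose 2) * y ^ Suc i)"
    by (simp add: sum.distrib[symmetric] algebra_simps power_mult_distrib)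
  also have "\<dots> = (\<Sum>i\<le>Suc m. qbinom Q (Suc m) i * Q ^ (i choose 2) * y ^ i)"
    by (subst sum.atMost_Suc_shift) (simp add: binomial_eq_0)
  finally show ?case .
qed (simp add: binomial_eq_0)

lemma prod_lessThan_add:
  fixes g :: "nat \<Rightarrow> 'a :: comm_monoid_mult"
  shows "(\<Prod>k<a + b. g k) = (\<Prod>k<a. g k) * (\<Prod>k<b. g (a + k))"
  by (induction b) (simp_all add: mult_ac)

text \<open>The q-binomial theorem with \<open>2 * N\<close> factors, centred: for
  \<open>y = z * x / x ^ (2 * N)\<close> the exponents of \<open>x\<close> in the factors run
  through the odd numbers from \<open>1 - 2 * N\<close> to \<open>2 * N - 1\<close>. The factors
  with negative exponent are turned around by pulling out \<open>z / x ^ (2*k+1)\<close>.\<close>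

lemma finite_triple_product:
  fixes x z :: real
  assumes "x \<noteq> 0" "z \<noteq> 0"
  shows "(\<Prod>k<N. (1 + z * x ^ (2*k+1)) * (1 + x ^ (2*k+1) / z))
       = (\<Sum>j\<in>{-int N..int N}. qbinom (x\<^sup>2) (2*N) (nat (int N + j)) * (x powi (j * j) * z powi j))"
proof -
  define y where "y = z * x / x ^ (2 * N)"
  define g where "g = (\<lambda>k. 1 + y * (x\<^sup>2) ^ k)"
  have 1: "(\<Prod>k<N. g (N + k)) = (\<Prod>k<N. 1 + z * x ^ (2*k+1))"
  proof (rule prod.cong)
    fix k
    have "(x\<^sup>2) ^ (N + k) = x ^ (2 * N) * x ^ (2 * k)"
      by (simp only: power_mult[symmetric] power_add[symmetric] distrib_left)
    thus "g (N + k) = 1 + z * x ^ (2*k+1)"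
      using assms by (simp add: g_def y_def)
  qed auto
  have "(\<Prod>k<N. g k) = (\<Prod>k<N. g (N - Suc k))"
    by (rule prod.nat_diff_reindex[symmetric])
  also have "\<dots> = (\<Prod>k<N. (z / x ^ (2*k+1)) * (1 + x ^ (2*k+1) / z))"
  proof (rule prod.cong)
    fix k assume "k \<in> {..<N}"
    hence N: "2 * N = 2 * (N - Suc k) + (2 * k + 1) + 1" by auto
    have "y * (x\<^sup>2) ^ (N - Suc k) = z / x ^ (2*k+1)"
      unfolding y_def N power_add power_one_right power_mult[symmetric] using assms by simp
    thus "g (N - Suc k) = (z / x ^ (2*k+1)) * (1 + x ^ (2*k+1) / z)"
      using assms by (simp add: g_def field_simps)
  qed auto
  also have "\<dots> = (\<Prod>k<N. z / x ^ (2*k+1)) * (\<Prod>k<N. 1 + x ^ (2*k+1) / z)"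
    by (rule prod.distrib)
  also have "(\<Prod>k<N. z / x ^ (2*k+1)) = z ^ N / x ^ (N * N)"
    by (induction N) (simp_all add: power_add field_simps power2_eq_square, simp add: power_mult power2_eq_square)
  finally have 2: "(\<Prod>k<N. g k) = z ^ N / x ^ (N * N) * (\<Prod>k<N. 1 + x ^ (2*k+1) / z)" .
  have "(\<Prod>k<2*N. g k) = z ^ N / x ^ (N * N) * (\<Prod>k<N. (1 + z * x ^ (2*k+1)) * (1 + x ^ (2*k+1) / z))"
    unfolding mult_2 prod_lessThan_add 1 2 by (simp add: prod.distrib)
  hence "(\<Prod>k<N. (1 + z * x ^ (2*k+1)) * (1 + x ^ (2*k+1) / z)) = x ^ (N * N) / z ^ N * (\<Prod>k<2*N. g k)"
    using assms by simp
  also have "\<dots> = x ^ (N * N) / z ^ N * (\<Sum>i\<le>2*N. qbinom (x\<^sup>2) (2*N) i * (x\<^sup>2) ^ (i choose 2) * y ^ i)"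
    unfolding g_def q_binomial_theorem ..
  also have "\<dots> = (\<Sum>i\<le>2*N. qbinom (x\<^sup>2) (2*N) i * (x powi ((int i - int N) * (int i - int N)) * z powi (int i - int N)))"
    unfolding sum_distrib_left
  proof (rule sum.cong)
    fix i assume "i \<in> {..2*N}"
    \<comment> \<open>The exponents in the q-binomial theorem are triangular; one factor
      \<open>x ^ i\<close> coming from \<open>y ^ i\<close> completes them to squares.\<close>
    have xpow: "(x\<^sup>2) ^ (i choose 2) * x ^ i = x ^ (i * i)"
    proof -
      have "2 * (i choose 2) + i = i * i"
        by (induction i) (auto simp: numeral_2_eq_2)
      thus ?thesis by (simp add: power_mult[symmetric] power_add[symmetric])
    qed
    have "x powi ((int i - int N) * (int i - int N)) = x powi (int (i * i + N * N) - int (2 * N * i))"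
      by (rule arg_cong[of _ _ "power_int x"]) (simp add: algebra_simps)
    also have "\<dots> = x ^ (i * i) * x ^ (N * N) / (x ^ (2 * N)) ^ i"
      using assms by (subst power_int_diff) (simp_all add: power_add power_mult del: of_nat_add of_nat_mult)
    finally have a: "x powi ((int i - int N) * (int i - int N))
         = (x\<^sup>2) ^ (i choose 2) * x ^ i * x ^ (N * N) / (x ^ (2 * N)) ^ i"
      by (simp only: xpow)
    have b: "z powi (int i - int N) = z ^ i / z ^ N"
      using assms by (simp add: power_int_diff)
    show "x ^ (N * N) / z ^ N * (qbinom (x\<^sup>2) (2*N) i * (x\<^sup>2) ^ (i choose 2) * y ^ i) =
       qbinom (x\<^sup>2) (2*N) i * (x powi ((int i - int N) * (int i - int N)) * z powi (int i - int N))"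
      unfolding a b y_def by (simp add: power_divide power_mult_distrib mult_ac)
  qed auto
  also have "\<dots> = (\<Sum>j\<in>{-int N..int N}. qbinom (x\<^sup>2) (2*N) (nat (int N + j)) * (x powi (j * j) * z powi j))"
    by (rule sum.reindex_bij_witness[of _ "\<lambda>j. nat (int N + j)" "\<lambda>i. int i - int N"]) auto
  finally show ?thesis .
qed

section \<open>Convergence of theta series and of the products\<close>

lemma summable_on_int:
  fixes f :: "int \<Rightarrow> real"
  assumes "summable (\<lambda>n. norm (f (int n)))" "summable (\<lambda>n. norm (f (- int n)))"
  shows "f summable_on UNIV"
proof -
  have "f summable_on range int"
    by (subst summable_on_reindex) (use norm_summable_imp_summable_on[OF assms(1)] in \<open>auto simp: o_def\<close>)
  moreover have "f summable_on range (\<lambda>n. - int n)"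
    by (subst summable_on_reindex) (use norm_summable_imp_summable_on[OF assms(2)] in \<open>auto simp: o_def inj_on_def\<close>)
  hence "f summable_on {..<0}"
  proof (rule summable_on_subset_banach)
    show "{..<0} \<subseteq> range (\<lambda>n. - int n)"
    proof
      fix j :: int assume "j \<in> {..<0}"
      hence "j = - int (nat (- j))" by simp
      thus "j \<in> range (\<lambda>n. - int n)" by blast
    qed
  qed
  ultimately have "f summable_on (range int \<union> {..<0})"
    by (rule summable_on_Un_disjoint) auto
  also have "range int \<union> {..<0} = UNIV"
    by (auto simp: image_iff) (metis nat_0_le not_less)
  finally show ?thesis .
qed

lemma summable_gauss:
  fixes x c :: real
  assumes "0 < x" "x < 1" "c > 0"
  shows "summable (\<lambda>n. x ^ (n * n) * c ^ n)"
proof (rule summable_comparison_test_ev)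
  have "(\<lambda>n. x ^ n * c) \<longlonglongrightarrow> 0 * c"
    using assms by (intro tendsto_intros LIMSEQ_power_zero) auto
  hence "eventually (\<lambda>n. x ^ n * c < 1 / 2) sequentially"
    by (rule order_tendstoD) auto
  thus "eventually (\<lambda>n. norm (x ^ (n * n) * c ^ n) \<le> (1 / 2) ^ n) sequentially"
  proof eventually_elim
    case (elim n)
    have "x ^ (n * n) * c ^ n = (x ^ n * c) ^ n"
      by (simp add: power_mult power_mult_distrib)
    also have "\<dots> \<le> (1 / 2) ^ n"
      using assms elim by (intro power_mono) auto
    finally show ?case using assms by simp
  qed
qed (simp add: summable_geometric)

lemma theta_summable:
  fixes x z :: real
  assumes "0 < x" "x < 1" "z \<noteq> 0"
  shows "(\<lambda>j::int. \<bar>x powi (j * j) * z powi j\<bar>) summable_on UNIV"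
proof (rule summable_on_int)
  have sq: "x powi (int n * int n) = x ^ (n * n)" for n
    by (metis of_nat_mult power_int_of_nat)
  have "norm \<bar>x powi (int n * int n) * z powi int n\<bar> = x ^ (n * n) * \<bar>z\<bar> ^ n" for n
    using assms by (simp add: sq abs_mult power_abs)
  thus "summable (\<lambda>n. norm \<bar>x powi (int n * int n) * z powi int n\<bar>)"
    using summable_gauss[OF assms(1,2), of "\<bar>z\<bar>"] assms by simp
  have "norm \<bar>x powi (- int n * - int n) * z powi (- int n)\<bar> = x ^ (n * n) * (1 / \<bar>z\<bar>) ^ n" for n
    using assms by (simp add: sq abs_mult power_abs power_int_minus power_divide divide_inverse power_inverse)
  thus "summable (\<lambda>n. norm \<bar>x powi (- int n * - int n) * z powi (- int n)\<bar>)"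
    using summable_gauss[OF assms(1,2), of "1 / \<bar>z\<bar>"] assms by simp
qed

lemma convergent_prod_linear_power:
  fixes c x :: real
  assumes "0 < x" "x < 1" "a > 0"
  shows "convergent_prod (\<lambda>n. 1 + c * x ^ (a * n + b))" "convergent_prod (\<lambda>n. 1 - c * x ^ (a * n + b))"
proof -
  have "x ^ a < 1"
    using assms by (simp add: power_less_one_iff)
  hence "summable (\<lambda>n. \<bar>c\<bar> * x ^ b * (x ^ a) ^ n)"
    using assms by (intro summable_mult summable_geometric) auto
  moreover have "norm (c * x ^ (a * n + b)) = \<bar>c\<bar> * x ^ b * (x ^ a) ^ n" for n
    using assms by (simp add: abs_mult power_add power_mult)
  ultimately have s: "summable (\<lambda>n. norm (c * x ^ (a * n + b)))"
    by simp
  show "convergent_prod (\<lambda>n. 1 + c * x ^ (a * n + b))" "convergent_prod (\<lambda>n. 1 - c * x ^ (a * n + b))"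
    by (intro abs_convergent_prod_imp_convergent_prod summable_imp_abs_convergent_prod; use s in simp)+
qed

text \<open>The limit of \<open>finite_triple_product\<close>: the Gaussian coefficients tend to
  \<open>1 / P\<close> and never exceed \<open>1 / P\<close>, so Tannery's theorem exchanges limit
  and sum, with the absolutely convergent theta series as majorant.\<close>

theorem jacobi_triple_product:
  fixes x z :: real
  assumes x: "0 < x" "x < 1" and z: "z \<noteq> 0"
  shows "((\<lambda>j::int. x powi (j * j) * z powi j) has_sum
           (\<Prod>n. 1 - x ^ (2*n+2)) * ((\<Prod>n. 1 + z * x ^ (2*n+1)) * (\<Prod>n. 1 + x ^ (2*n+1) / z))) UNIV"
proof -
  define Q where "Q = x\<^sup>2"
  have Q: "0 < Q" "Q < 1"
    using x by (simp_all add: Q_def power_less_one_iff)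
  define P where "P = (\<Prod>n. 1 - x ^ (2*n+2))"
  have convP: "convergent_prod (\<lambda>n. 1 - x ^ (2*n+2))"
    using convergent_prod_linear_power(2)[OF x, of 2 1 2] by simp
  have qpoch_eq: "qpoch Q m = (\<Prod>n<m. 1 - x ^ (2*n+2))" for m
    by (simp add: qpoch_def Q_def power_mult[symmetric] power_add[symmetric])
  have qpoch_lim: "qpoch Q \<longlonglongrightarrow> P"
    unfolding P_def qpoch_eq using convergent_prod_LIMSEQ[OF convP]
    by (simp add: LIMSEQ_lessThan_iff_atMost)
  have qpoch_pos: "qpoch Q m > 0" for m
    unfolding qpoch_def using Q by (intro prod_pos) (auto simp: power_less_one_iff simp del: power_Suc)
  have "decseq (qpoch Q)"
    using qpoch_pos Q by (intro decseq_SucI) (simp_all add: qpoch_def mult_left_le)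
  hence dec: "m \<le> n \<Longrightarrow> qpoch Q n \<le> qpoch Q m" for m n
    by (simp add: decseq_def)
  have P_le: "P \<le> qpoch Q m" for m
    using \<open>decseq (qpoch Q)\<close> qpoch_lim by (rule decseq_ge)
  have "P \<noteq> 0"
  proof -
    have "x ^ (2*n+2) < 1" for n
      using x by (subst power_less_one_iff) auto
    hence "1 - x ^ (2*n+2) \<noteq> 0" for n
      by (metis diff_gt_0_iff_gt less_irrefl)
    thus ?thesis
      unfolding P_def by (intro prodinf_nonzero convP)
  qed
  moreover have "P \<ge> 0"
    using qpoch_lim by (rule LIMSEQ_le_const) (use qpoch_pos less_imp_le in blast)
  ultimately have P: "P > 0" by simp
  have qbin_eq: "qbinom Q (a + b) a = qpoch Q (a + b) / (qpoch Q a * qpoch Q b)" for a b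
    using qbinom_qpoch[of Q a b] qpoch_pos[of a] qpoch_pos[of b] by (simp add: eq_divide_eq)
  have qbin_nonneg: "qbinom Q m i \<ge> 0" for m i
    using Q by (induction Q m i rule: qbinom.induct) auto
  have qbin_le: "qbinom Q (a + b) a \<le> 1 / P" for a b
  proof -
    have "qbinom Q (a + b) a \<le> qpoch Q a / (qpoch Q a * qpoch Q b)"
      unfolding qbin_eq using qpoch_pos[of a] qpoch_pos[of b] dec[of a "a + b"] by (intro divide_right_mono) auto
    also have "\<dots> = 1 / qpoch Q b"
      using qpoch_pos[of a] by simp
    also have "\<dots> \<le> 1 / P"
      using P P_le qpoch_pos by (intro divide_left_mono) auto
    finally show ?thesis .
  qed

  define t where "t = (\<lambda>j::int. x powi (j * j) * z powi j)"
  \<comment> \<open>Extended by 0 to all integers \<open>j\<close>, so that the index set of the sum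
    no longer depends on \<open>N\<close>.\<close>
  define a where "a = (\<lambda>j::int. \<lambda>N::nat. if \<bar>j\<bar> \<le> int N then qbinom Q (2*N) (nat (int N + j)) * t j else 0)"
  have a_bound: "norm (a j N) \<le> 1 / P * \<bar>t j\<bar>" for j N
  proof (cases "\<bar>j\<bar> \<le> int N")
    case True
    hence "2 * N = nat (int N + j) + nat (int N - j)" by auto
    hence "qbinom Q (2*N) (nat (int N + j)) \<le> 1 / P"
      using qbin_le by metis
    hence "qbinom Q (2*N) (nat (int N + j)) * \<bar>t j\<bar> \<le> 1 / P * \<bar>t j\<bar>"
      by (rule mult_right_mono) auto
    thus ?thesis
      using True qbin_nonneg by (simp add: a_def abs_mult)
  qed (use P in \<open>simp add: a_def\<close>)
  have a_lim: "a j \<longlonglongrightarrow> 1 / P * t j" for j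
  proof -
    have l1: "(\<lambda>N. qpoch Q (2 * N)) \<longlonglongrightarrow> P"
      by (rule filterlim_compose[OF qpoch_lim]) (simp add: mult_nat_left_at_top)
    have l2: "(\<lambda>N. qpoch Q (nat (int N + i))) \<longlonglongrightarrow> P" for i
    proof (rule filterlim_compose[OF qpoch_lim], unfold filterlim_at_top, rule allI)
      fix Z :: nat
      show "eventually (\<lambda>N. Z \<le> nat (int N + i)) sequentially"
        by (rule eventually_sequentiallyI[of "nat (int Z + \<bar>i\<bar>)"]) auto
    qed
    have "(\<lambda>N. qpoch Q (2 * N) / (qpoch Q (nat (int N + j)) * qpoch Q (nat (int N + (-j)))) * t j)
           \<longlonglongrightarrow> P / (P * P) * t j"
      using P by (intro tendsto_intros l1 l2) auto
    moreover have "eventually (\<lambda>N. qpoch Q (2 * N) / (qpoch Q (nat (int N + j)) * qpoch Q (nat (int N + (-j)))) * t j = a j N) sequentially"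
    proof (rule eventually_sequentiallyI[of "nat \<bar>j\<bar>"])
      fix N assume "nat \<bar>j\<bar> \<le> N"
      hence N: "\<bar>j\<bar> \<le> int N" and "2 * N = nat (int N + j) + nat (int N + (-j))" by auto
      thus "qpoch Q (2 * N) / (qpoch Q (nat (int N + j)) * qpoch Q (nat (int N + (-j)))) * t j = a j N"
        using qbin_eq[of "nat (int N + j)" "nat (int N + (-j))"] by (simp add: a_def)
    qed
    ultimately show ?thesis
      using P by (simp add: tendsto_cong)
  qed
  have "(\<lambda>j. 1 / P * \<bar>t j\<bar>) summable_on UNIV"
    unfolding t_def by (intro summable_on_cmult_right theta_summable assms)
  \<comment> \<open>\<open>int_decode\<close> enumerates the integers, as Tannery's theorem concerns
    series over the naturals.\<close>
  hence "(\<lambda>k. 1 / P * \<bar>t (int_decode k)\<bar>) summable_on UNIV"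
    by (subst summable_on_reindex_bij_betw[OF bij_int_decode])
  hence summ: "summable (\<lambda>k. 1 / P * \<bar>t (int_decode k)\<bar>)"
    by (rule summable_on_imp_summable)

  have a_sum: "(\<Sum>k. a (int_decode k) N) = (\<Prod>k<N. (1 + z * x ^ (2*k+1)) * (1 + x ^ (2*k+1) / z))" for N
  proof -
    have "((\<lambda>j. a j N) has_sum (\<Sum>j\<in>{-int N..int N}. a j N)) {-int N..int N}"
      by (rule has_sum_finite) auto
    also have "(\<Sum>j\<in>{-int N..int N}. a j N) = (\<Prod>k<N. (1 + z * x ^ (2*k+1)) * (1 + x ^ (2*k+1) / z))"
      using x z by (subst finite_triple_product) (auto simp: a_def Q_def t_def intro!: sum.cong)
    finally have "((\<lambda>j. a j N) has_sum (\<Prod>k<N. (1 + z * x ^ (2*k+1)) * (1 + x ^ (2*k+1) / z))) UNIV"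
      by (subst has_sum_cong_neutral[where S = UNIV and T = "{-int N..int N}"]) (auto simp: a_def)
    hence "((\<lambda>k. a (int_decode k) N) has_sum (\<Prod>k<N. (1 + z * x ^ (2*k+1)) * (1 + x ^ (2*k+1) / z))) UNIV"
      by (subst has_sum_reindex_bij_betw[OF bij_int_decode])
    from sums_unique[OF has_sum_imp_sums[OF this]] show ?thesis
      by (rule sym)
  qed
  have "eventually (\<lambda>N. summable (\<lambda>k. norm (a (int_decode k) N))) sequentially \<and>
      summable (\<lambda>k. norm (1 / P * t (int_decode k))) \<and>
      (\<lambda>N. \<Sum>k. a (int_decode k) N) \<longlonglongrightarrow> (\<Sum>k. 1 / P * t (int_decode k))"
    by (rule tannerys_theorem[OF a_lim _ summ]) (use a_bound in \<open>auto simp: case_prod_unfold\<close>)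
  hence tsum: "summable (\<lambda>k. norm (1 / P * t (int_decode k)))"
    and "(\<lambda>N. \<Prod>k<N. (1 + z * x ^ (2*k+1)) * (1 + x ^ (2*k+1) / z)) \<longlonglongrightarrow> (\<Sum>k. 1 / P * t (int_decode k))"
    unfolding a_sum by blast+
  note this(2)
  moreover have "(\<lambda>N. \<Prod>k<N. (1 + z * x ^ (2*k+1)) * (1 + x ^ (2*k+1) / z))
      \<longlonglongrightarrow> (\<Prod>n. 1 + z * x ^ (2*n+1)) * (\<Prod>n. 1 + x ^ (2*n+1) / z)"
  proof -
    have "convergent_prod (\<lambda>n. 1 + z * x ^ (2*n+1))" "convergent_prod (\<lambda>n. 1 + x ^ (2*n+1) / z)"
      using convergent_prod_linear_power(1)[OF x, of 2 z 1] convergent_prod_linear_power(1)[OF x, of 2 "1/z" 1] by auto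
    thus ?thesis
      unfolding prod.distrib by (intro tendsto_mult)
       (auto dest!: convergent_prod_LIMSEQ simp: LIMSEQ_lessThan_iff_atMost)
  qed
  ultimately have eq: "(\<Sum>k. 1 / P * t (int_decode k)) = (\<Prod>n. 1 + z * x ^ (2*n+1)) * (\<Prod>n. 1 + x ^ (2*n+1) / z)"
    by (rule LIMSEQ_unique)
  have "((\<lambda>k. 1 / P * t (int_decode k)) has_sum (\<Sum>k. 1 / P * t (int_decode k))) UNIV"
    using tsum by (intro norm_summable_imp_has_sum summable_sums summable_norm_cancel[OF tsum])
  hence "((\<lambda>j. 1 / P * t j) has_sum (\<Sum>k. 1 / P * t (int_decode k))) UNIV"
    by (subst (asm) has_sum_reindex_bij_betw[OF bij_int_decode])
  hence "((\<lambda>j. P * (1 / P * t j)) has_sum (P * (\<Sum>k. 1 / P * t (int_decode k)))) UNIV"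
    by (rule has_sum_cmult_right)
  thus ?thesis
    unfolding eq using P by (simp add: t_def P_def)
qed

section \<open>Infinite products and sums over the integers\<close>

lemma prodinf_split2:
  fixes g :: "nat \<Rightarrow> real"
  assumes "convergent_prod g" "convergent_prod (\<lambda>n. g (2 * n))" "convergent_prod (\<lambda>n. g (2 * n + 1))"
  shows "(\<Prod>n. g (2 * n)) * (\<Prod>n. g (2 * n + 1)) = prodinf g"
proof (rule LIMSEQ_unique)
  have lim: "(\<lambda>N. \<Prod>n<N. h n) \<longlonglongrightarrow> prodinf h" if "convergent_prod h" for h :: "nat \<Rightarrow> real"
    using convergent_prod_LIMSEQ[OF that] by (simp add: LIMSEQ_lessThan_iff_atMost)
  show "(\<lambda>N. (\<Prod>n<N. g (2 * n)) * (\<Prod>n<N. g (2 * n + 1))) \<longlonglongrightarrow> (\<Prod>n. g (2 * n)) * (\<Prod>n. g (2 * n + 1))"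
    by (intro tendsto_mult lim assms)
  have "(\<lambda>N. \<Prod>n<2 * N. g n) \<longlonglongrightarrow> prodinf g"
    by (rule filterlim_compose[OF lim[OF assms(1)]]) (simp add: mult_nat_left_at_top)
  moreover have "(\<Prod>n<2 * N. g n) = (\<Prod>n<N. g (2 * n)) * (\<Prod>n<N. g (2 * n + 1))" for N
    by (induction N) (simp_all add: mult_ac)
  ultimately show "(\<lambda>N. (\<Prod>n<N. g (2 * n)) * (\<Prod>n<N. g (2 * n + 1))) \<longlonglongrightarrow> prodinf g"
    by simp
qed

lemma prodinf_split3:
  fixes g :: "nat \<Rightarrow> real"
  assumes "convergent_prod g" "convergent_prod (\<lambda>n. g (3 * n))" "convergent_prod (\<lambda>n. g (3 * n + 1))"
    "convergent_prod (\<lambda>n. g (3 * n + 2))"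
  shows "(\<Prod>n. g (3 * n)) * (\<Prod>n. g (3 * n + 1)) * (\<Prod>n. g (3 * n + 2)) = prodinf g"
proof (rule LIMSEQ_unique)
  have lim: "(\<lambda>N. \<Prod>n<N. h n) \<longlonglongrightarrow> prodinf h" if "convergent_prod h" for h :: "nat \<Rightarrow> real"
    using convergent_prod_LIMSEQ[OF that] by (simp add: LIMSEQ_lessThan_iff_atMost)
  show "(\<lambda>N. (\<Prod>n<N. g (3 * n)) * (\<Prod>n<N. g (3 * n + 1)) * (\<Prod>n<N. g (3 * n + 2)))
     \<longlonglongrightarrow> (\<Prod>n. g (3 * n)) * (\<Prod>n. g (3 * n + 1)) * (\<Prod>n. g (3 * n + 2))"
    by (intro tendsto_mult lim assms)
  have "(\<lambda>N. \<Prod>n<3 * N. g n) \<longlonglongrightarrow> prodinf g"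
    by (rule filterlim_compose[OF lim[OF assms(1)]]) (simp add: mult_nat_left_at_top)
  moreover have "(\<Prod>n<3 * N. g n) = (\<Prod>n<N. g (3 * n)) * (\<Prod>n<N. g (3 * n + 1)) * (\<Prod>n<N. g (3 * n + 2))" for N
    by (induction N) (simp_all add: mult_ac numeral_3_eq_3)
  ultimately show "(\<lambda>N. (\<Prod>n<N. g (3 * n)) * (\<Prod>n<N. g (3 * n + 1)) * (\<Prod>n<N. g (3 * n + 2))) \<longlonglongrightarrow> prodinf g"
    by simp
qed

lemma prodinf_linear_power_pos:
  fixes q :: real
  assumes "0 < q" "q < 1" "a > 0" "b > 0"
  shows "(\<Prod>n. 1 - q ^ (a * n + b)) > 0"
proof (rule less_0_prodinf)
  show "convergent_prod (\<lambda>n. 1 - q ^ (a * n + b))"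
    using convergent_prod_linear_power(2)[of q a 1 b] assms by simp
  show "1 - q ^ (a * n + b) > 0" for n
    using assms by (simp add: power_less_one_iff)
qed

text \<open>Euler's identity between partitions into distinct and into odd parts. From
  \<open>(1 - q^n) * (1 + q^n) = 1 - q^(2*n)\<close>, each factor is a quotient of the products over
  all and over even exponents, and the two quotients are inverse to each other.\<close>

lemma euler_odd_distinct:
  fixes q :: real
  assumes q: "0 < q" "q < 1"
  shows "(\<Prod>n. 1 + q ^ (n + 1)) * (\<Prod>n. 1 - q ^ (2 * n + 1)) = 1"
proof -
  note conv = convergent_prod_linear_power[OF q, of _ 1, simplified]
  let ?P = "\<Prod>n. 1 - q ^ (n + 1)" and ?E = "\<Prod>n. 1 - q ^ (2 * n + 2)" and ?O = "\<Prod>n. 1 - q ^ (2 * n + 1)"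
    and ?S = "\<Prod>n. 1 + q ^ (n + 1)"
  have OE: "?O * ?E = ?P"
    using prodinf_split2[of "\<lambda>n. 1 - q ^ (n + 1)"] conv(2)[of 1 1] conv(2)[of 2 1] conv(2)[of 2 2]
    by simp
  have PS: "?P * ?S = ?E"
  proof -
    have "?P * ?S = (\<Prod>n. (1 - q ^ (n + 1)) * (1 + q ^ (n + 1)))"
      using conv[of 1 1] by (intro prodinf_mult) simp_all
    also have "(\<lambda>n. (1 - q ^ (n + 1)) * (1 + q ^ (n + 1))) = (\<lambda>n. 1 - q ^ (2 * n + 2))"
      by (simp add: algebra_simps power_add[symmetric] mult_2[symmetric])
    finally show ?thesis .
  qed
  have E: "?E \<noteq> 0"
    using prodinf_linear_power_pos[OF q, of 2 2] by simp
  have "?E * (?S * ?O) = ?O * ?E * ?S"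
    by (simp only: mult_ac)
  also have "\<dots> = ?E * 1"
    by (simp only: OE PS mult_1_right)
  finally show ?thesis
    by (rule mult_left_cancel[OF E, THEN iffD1])
qed

text \<open>The first part is Euler's identity for \<open>q ^ 3\<close>; dividing the identity for
  \<open>q\<close> by it leaves the exponents prime to 3. This turns the plus-sign products of
  \<open>one_plus_inverse_cubic_cf\<close> into those of the continued fraction.\<close>

lemma euler_mod6:
  fixes q :: real
  assumes q: "0 < q" "q < 1"
  shows "(\<Prod>n. 1 + q ^ (3*n+3)) * (\<Prod>n. 1 - q ^ (6*n+3)) = 1"
    and "(\<Prod>n. 1 - q ^ (6*n+1)) * (\<Prod>n. 1 - q ^ (6*n+5)) * ((\<Prod>n. 1 + q ^ (3*n+1)) * (\<Prod>n. 1 + q ^ (3*n+2))) = 1"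
proof -
  note conv = convergent_prod_linear_power[OF q, of _ 1, simplified]
  have q3: "0 < q ^ 3" "q ^ 3 < 1"
    using q by (simp_all add: power_less_one_iff)
  have e: "(q ^ 3) ^ (n + 1) = q ^ (3 * n + 3)" "(q ^ 3) ^ (2 * n + 1) = q ^ (6 * n + 3)" for n :: nat
    by (subst power_mult[symmetric], rule arg_cong[of _ _ "power q"], simp)+
  show 1: "(\<Prod>n. 1 + q ^ (3*n+3)) * (\<Prod>n. 1 - q ^ (6*n+3)) = 1"
    using euler_odd_distinct[OF q3] unfolding e(2) unfolding e(1) .
  have "(\<Prod>n. 1 + q ^ (3*n+1)) * (\<Prod>n. 1 + q ^ (3*n+2)) * (\<Prod>n. 1 + q ^ (3*n+3)) = (\<Prod>n. 1 + q ^ (n + 1))"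
    using prodinf_split3[of "\<lambda>n. 1 + q ^ (n + 1)"] conv(1)[of 1 1] conv(1)[of 3 1] conv(1)[of 3 2] conv(1)[of 3 3]
    by (simp add: numeral_3_eq_3)
  moreover have "(\<Prod>n. 1 - q ^ (6*n+1)) * (\<Prod>n. 1 - q ^ (6*n+3)) * (\<Prod>n. 1 - q ^ (6*n+5)) = (\<Prod>n. 1 - q ^ (2 * n + 1))"
  proof -
    have e: "2 * (3 * n) + 1 = 6 * n + 1" "2 * (3 * n + 1) + 1 = 6 * n + 3" "2 * (3 * n + 2) + 1 = 6 * n + 5" for n :: nat
      by simp_all
    show ?thesis
      using prodinf_split3[of "\<lambda>n. 1 - q ^ (2 * n + 1)"] conv(2)[of 2 1] conv(2)[of 6 1] conv(2)[of 6 3] conv(2)[of 6 5]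
      unfolding e by simp
  qed
  ultimately have "((\<Prod>n. 1 + q ^ (3*n+1)) * (\<Prod>n. 1 + q ^ (3*n+2)) * (\<Prod>n. 1 + q ^ (3*n+3))) *
     ((\<Prod>n. 1 - q ^ (6*n+1)) * (\<Prod>n. 1 - q ^ (6*n+3)) * (\<Prod>n. 1 - q ^ (6*n+5))) = 1"
    using euler_odd_distinct[OF q] by (simp only:)
  hence "(\<Prod>n. 1 - q ^ (6*n+1)) * (\<Prod>n. 1 - q ^ (6*n+5)) * ((\<Prod>n. 1 + q ^ (3*n+1)) * (\<Prod>n. 1 + q ^ (3*n+2)))
      * ((\<Prod>n. 1 + q ^ (3*n+3)) * (\<Prod>n. 1 - q ^ (6*n+3))) = 1"
    by (simp only: mult_ac)
  thus "(\<Prod>n. 1 - q ^ (6*n+1)) * (\<Prod>n. 1 - q ^ (6*n+5)) * ((\<Prod>n. 1 + q ^ (3*n+1)) * (\<Prod>n. 1 + q ^ (3*n+2))) = 1"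
    unfolding 1 mult_1_right .
qed

section \<open>Sums over the integers by sign and by residue modulo 3\<close>

lemma has_sum_int_split:
  fixes f :: "int \<Rightarrow> real"
  assumes "((\<lambda>n. f (int n)) has_sum a) UNIV" "((\<lambda>n. f (- 1 - int n)) has_sum b) UNIV"
  shows "(f has_sum (a + b)) UNIV"
proof -
  have "(f has_sum a) (range int)"
    by (subst has_sum_reindex) (use assms(1) in \<open>auto simp: o_def\<close>)
  moreover have "(f has_sum b) (range (\<lambda>n. - 1 - int n))"
    by (subst has_sum_reindex) (use assms(2) in \<open>auto simp: o_def inj_on_def\<close>)
  ultimately have "(f has_sum (a + b)) (range int \<union> range (\<lambda>n. - 1 - int n))"
    by (rule has_sum_Un_disjoint) auto
  also have "range int \<union> range (\<lambda>n. - 1 - int n) = UNIV"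
  proof (rule set_eqI)
    fix j :: int
    show "j \<in> range int \<union> range (\<lambda>n. - 1 - int n) \<longleftrightarrow> j \<in> UNIV"
    proof (cases "j \<ge> 0")
      case True
      hence "j = int (nat j)" by simp
      thus ?thesis by blast
    next
      case False
      hence "j = - 1 - int (nat (- 1 - j))" by simp
      thus ?thesis by blast
    qed
  qed
  finally show ?thesis .
qed

lemma has_sum_int_mod3:
  fixes f :: "int \<Rightarrow> real"
  assumes "((\<lambda>m. f (3 * m)) has_sum a) UNIV" "((\<lambda>m. f (3 * m + 1)) has_sum b) UNIV"
    "((\<lambda>m. f (3 * m - 1)) has_sum c) UNIV"
  shows "(f has_sum (a + b + c)) UNIV"
proof -
  have "(f has_sum a) (range (\<lambda>m. 3 * m))" "(f has_sum b) (range (\<lambda>m. 3 * m + 1))"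
       "(f has_sum c) (range (\<lambda>m. 3 * m - 1))"
    by (subst has_sum_reindex; use assms in \<open>auto simp: o_def inj_on_def\<close>)+
  hence "(f has_sum (a + b + c)) (range (\<lambda>m. 3 * m) \<union> range (\<lambda>m. 3 * m + 1) \<union> range (\<lambda>m. 3 * m - 1))"
    by (intro has_sum_Un_disjoint) (auto simp: image_iff, presburger+)
  also have "range (\<lambda>m. 3 * m) \<union> range (\<lambda>m. 3 * m + 1) \<union> range (\<lambda>m. 3 * m - 1) = (UNIV :: int set)"
    by (auto simp: image_iff) presburger
  finally show ?thesis .
qed

section \<open>Poisson summation for Gaussians\<close>

text \<open>The characteristic function of the standard normal distribution, rescaled by
  \<open>sqrt (2 * pi * s)\<close> so that the exponent \<open>x^2 / 2\<close> becomes
  \<open>pi * s * y^2\<close>.\<close>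

lemma gauss_cos_integral:
  fixes s t :: real
  assumes "s > 0"
  shows "((\<lambda>y. exp (- pi * s * y\<^sup>2) * cos (2 * pi * t * y)) has_integral (exp (- pi * t\<^sup>2 / s) / sqrt s)) UNIV"
    and "(\<lambda>y. exp (- pi * s * y\<^sup>2)) integrable_on UNIV"
proof -
  define r where "r = sqrt (2 * pi * s)"
  have r: "r > 0" "r\<^sup>2 = 2 * pi * s"
    using assms by (simp_all add: r_def)
  define c where "c = 2 * pi * t / r"
  interpret std: real_distribution std_normal_distribution
    by (rule real_dist_normal_dist)
  have int1: "integrable lborel (\<lambda>x. std_normal_density x * cos (c * x))"
    by (rule Bochner_Integration.integrable_bound[OF integrable_normal_density[where \<mu> = 0 and \<sigma> = 1]])
       (auto simp: abs_mult mult_left_le)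
  have "Re (char std_normal_distribution c) = (\<integral>x. Re (iexp (c * x)) \<partial>std_normal_distribution)"
    unfolding char_def by (rule integral_Re[symmetric]) (rule std.integrable_iexp; simp)
  also have "\<dots> = (\<integral>x. std_normal_density x * cos (c * x) \<partial>lborel)"
    by (subst integral_density) (auto simp: Re_exp normal_density_nonneg)
  finally have val: "(\<integral>x. std_normal_density x * cos (c * x) \<partial>lborel) = exp (- c\<^sup>2 / 2)"
    by (simp add: char_std_normal_distribution)
  have "((\<lambda>y. std_normal_density (0 + r * y) * cos (c * (0 + r * y))) has_integral exp (- c\<^sup>2 / 2) / r) UNIV"
  proof -
    have "integrable lborel (\<lambda>y. std_normal_density (0 + r * y) * cos (c * (0 + r * y)))"
      using lborel_integrable_real_affine[OF int1, of r 0] r by simp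
    moreover have "(\<integral>y. std_normal_density (0 + r * y) * cos (c * (0 + r * y)) \<partial>lborel) = exp (- c\<^sup>2 / 2) / r"
      using lborel_integral_real_affine[of r "\<lambda>x. std_normal_density x * cos (c * x)" 0] r val
      by (simp add: field_simps)
    ultimately show ?thesis
      using has_integral_integral_lborel by metis
  qed
  hence "((\<lambda>y. sqrt (2 * pi) * (std_normal_density (0 + r * y) * cos (c * (0 + r * y)))) has_integral
      sqrt (2 * pi) * (exp (- c\<^sup>2 / 2) / r)) UNIV"
    by (rule has_integral_mult_right)
  moreover have "sqrt (2 * pi) * (std_normal_density (0 + r * y) * cos (c * (0 + r * y)))
       = exp (- pi * s * y\<^sup>2) * cos (2 * pi * t * y)" for y
    using r by (simp add: normal_density_def c_def power_mult_distrib mult.assoc)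
  moreover have "sqrt (2 * pi) * (exp (- c\<^sup>2 / 2) / r) = exp (- pi * t\<^sup>2 / s) / sqrt s"
  proof -
    have "c\<^sup>2 / 2 = pi * t\<^sup>2 / s"
    proof -
      have "c\<^sup>2 = (2 * pi * t)\<^sup>2 / (2 * pi * s)"
        by (simp only: c_def power_divide r)
      also have "\<dots> / 2 = pi * t\<^sup>2 / s"
        using assms by (simp add: power2_eq_square)
      finally show ?thesis .
    qed
    thus ?thesis
      by (simp add: r_def real_sqrt_mult)
  qed
  ultimately show "((\<lambda>y. exp (- pi * s * y\<^sup>2) * cos (2 * pi * t * y)) has_integral (exp (- pi * t\<^sup>2 / s) / sqrt s)) UNIV"
    by simp
  have "integrable lborel (\<lambda>y. std_normal_density (0 + r * y))"
    using lborel_integrable_real_affine[OF integrable_normal_density[where \<mu> = 0 and \<sigma> = 1], of r 0] r by simp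
  hence "(\<lambda>y. std_normal_density (0 + r * y)) integrable_on UNIV"
    by (rule integrable_on_lborel)
  hence "(\<lambda>y. sqrt (2 * pi) * std_normal_density (0 + r * y)) integrable_on UNIV"
    by (rule integrable_on_mult_right)
  moreover have "sqrt (2 * pi) * std_normal_density (0 + r * y) = exp (- pi * s * y\<^sup>2)" for y
    using r by (simp add: normal_density_def power_mult_distrib mult.assoc)
  ultimately show "(\<lambda>y. exp (- pi * s * y\<^sup>2)) integrable_on UNIV"
    by (simp only:)
qed

text \<open>By symmetry \<open>D x = h (cos (2 \<pi> x))\<close> with \<open>h\<close> continuous, and \<open>h\<close> is a uniform limit of
  polynomials.\<close>

lemma cos_coeffs_zero_imp_zero:
  fixes D :: "real \<Rightarrow> real"
  assumes cont: "continuous_on {0..1} D"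
    and sym: "\<And>x. x \<in> {0..1} \<Longrightarrow> D (1 - x) = D x"
    and coeff: "\<And>j::nat. integral {0..1} (\<lambda>x. D x * cos (2 * pi * real j * x)) = 0"
    and x: "x \<in> {0..1}"
  shows "D x = 0"
proof -
  define h where "h = (\<lambda>y. D (arccos y / (2 * pi)))"
  have range: "arccos y / (2 * pi) \<in> {0..1}" if "y \<in> {-1..1}" for y
    using arccos_lbound[of y] arccos_ubound[of y] that pi_gt_zero by (auto simp: field_simps)
  have h_cont: "continuous_on {-1..1} h"
    unfolding h_def by (rule continuous_on_compose2[OF cont]) (use range in \<open>auto intro!: continuous_intros\<close>)
  have h_cos: "h (cos (2 * pi * x)) = D x" if "x \<in> {0..1}" for x
  proof (cases "x \<le> 1 / 2")
    case True
    hence "arccos (cos (2 * pi * x)) = 2 * pi * x"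
      using that by (intro arccos_cos) auto
    thus ?thesis by (simp add: h_def)
  next
    case False
    have "cos (2 * pi * x) = cos (2 * pi * (1 - x))"
      by (simp add: algebra_simps cos_diff)
    also have "arccos \<dots> = 2 * pi * (1 - x)"
      using that False by (intro arccos_cos) auto
    finally show ?thesis using sym[OF that] by (simp add: h_def)
  qed
  have D_int: "(\<lambda>x. D x * g x) integrable_on {0..1}" if "continuous_on {0..1} g" for g
    using that by (intro integrable_continuous_real continuous_intros cont)
  \<comment> \<open>The product-to-sum formula trades one power of the cosine for the frequencies
    \<open>j + 1\<close> and \<open>j - 1\<close>; integer \<open>j\<close> is needed since 0 leads
    to -1.\<close>
  have moment: "integral {0..1} (\<lambda>x. D x * (cos (2 * pi * of_int j * x) * cos (2 * pi * x) ^ n)) = 0" for j :: int and n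
  proof (induction n arbitrary: j)
    case 0
    show ?case
    proof (cases j)
      case (nonneg m) thus ?thesis using coeff[of m] by simp
    next
      case (neg m)
      have "2 * pi * of_int j * x = - (2 * pi * real (Suc m) * x)" for x
        by (simp add: neg algebra_simps)
      hence "cos (2 * pi * of_int j * x) = cos (2 * pi * real (Suc m) * x)" for x
        by (simp only: cos_minus)
      thus ?thesis using coeff[of "Suc m"] by (simp only: power_0 mult_1_right)
    qed
  next
    case (Suc n)
    let ?I = "\<lambda>j::int. \<lambda>x. D x * (cos (2 * pi * of_int j * x) * cos (2 * pi * x) ^ n)"
    have "D x * (cos (2 * pi * of_int j * x) * cos (2 * pi * x) ^ Suc n) = (?I (j + 1) x + ?I (j - 1) x) / 2" for x
    proof -
      have "cos (2 * pi * of_int j * x) * cos (2 * pi * x)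
         = (cos (2 * pi * of_int (j - 1) * x) + cos (2 * pi * of_int (j + 1) * x)) / 2"
      proof -
        have "2 * pi * of_int (j - 1) * x = 2 * pi * of_int j * x - 2 * pi * x"
             "2 * pi * of_int (j + 1) * x = 2 * pi * of_int j * x + 2 * pi * x"
          by (simp_all add: algebra_simps)
        thus ?thesis by (simp only: cos_times_cos)
      qed
      hence "D x * (cos (2 * pi * of_int j * x) * cos (2 * pi * x) ^ Suc n)
         = D x * (((cos (2 * pi * of_int (j - 1) * x) + cos (2 * pi * of_int (j + 1) * x)) / 2) * cos (2 * pi * x) ^ n)"
        by (simp only: power_Suc mult.assoc[symmetric])
      thus ?thesis by (simp only: distrib_left distrib_right add_divide_distrib times_divide_eq_left times_divide_eq_right add.commute)
    qed
    hence "integral {0..1} (\<lambda>x. D x * (cos (2 * pi * of_int j * x) * cos (2 * pi * x) ^ Suc n))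
       = integral {0..1} (\<lambda>x. (?I (j + 1) x + ?I (j - 1) x) / 2)"
      by (simp only:)
    also have "\<dots> = (integral {0..1} (?I (j + 1)) + integral {0..1} (?I (j - 1))) / 2"
      by (subst integral_divide, subst Henstock_Kurzweil_Integration.integral_add)
         (auto intro!: D_int continuous_intros)
    also have "\<dots> = 0"
      by (simp only: Suc.IH) simp
    finally show ?case .
  qed
  have poly: "integral {0..1} (\<lambda>x. D x * (\<Sum>i\<le>n. a i * cos (2 * pi * x) ^ i)) = 0" for a :: "nat \<Rightarrow> real" and n
  proof -
    have "integral {0..1} (\<lambda>x. D x * (\<Sum>i\<le>n. a i * cos (2 * pi * x) ^ i))
        = integral {0..1} (\<lambda>x. \<Sum>i\<le>n. a i * (D x * cos (2 * pi * x) ^ i))"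
      by (simp add: sum_distrib_left mult_ac)
    also have "\<dots> = (\<Sum>i\<le>n. integral {0..1} (\<lambda>x. a i * (D x * cos (2 * pi * x) ^ i)))"
      by (rule integral_sum) (auto intro!: integrable_on_mult_right D_int continuous_intros)
    also have "\<dots> = 0"
      using moment[of 0] by simp
    finally show ?thesis .
  qed
  obtain C where C: "\<And>x. x \<in> {0..1} \<Longrightarrow> \<bar>D x\<bar> \<le> C" "C > 0"
  proof -
    have "bounded (D ` {0..1})"
      by (intro compact_imp_bounded compact_continuous_image cont) auto
    then obtain b where "b > 0" "\<forall>y\<in>D ` {0..1}. norm y \<le> b"
      unfolding bounded_pos by blast
    thus ?thesis
      by (intro that[of b]) auto
  qed
  \<comment> \<open>Orthogonality to polynomials in \<open>cos (2 * pi * x)\<close> makes the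
    integral of \<open>D * D\<close> equal to that of \<open>D * (D - g)\<close>, whose integrand is
    at most \<open>C * (e / C)\<close>.\<close>
  have small: "integral {0..1} (\<lambda>x. D x * D x) \<le> e" if "e > 0" for e
  proof -
    have "e / C > 0" using that C by simp
    then obtain g where g: "real_polynomial_function g" "\<And>y. y \<in> {-1..1} \<Longrightarrow> \<bar>h y - g y\<bar> < e / C"
      using Stone_Weierstrass_real_polynomial_function[of "{-1..1::real}" h "e / C"] h_cont by blast
    obtain a n where an: "g = (\<lambda>y. \<Sum>i\<le>n. a i * y ^ i)"
      using g(1) unfolding real_polynomial_function_iff_sum by blast
    let ?g = "\<lambda>x. g (cos (2 * pi * x))"
    have gc: "continuous_on {0..1} ?g"
      unfolding an by (intro continuous_intros)
    have "integral {0..1} (\<lambda>x. D x * D x) = integral {0..1} (\<lambda>x. D x * D x) - integral {0..1} (\<lambda>x. D x * ?g x)"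
      unfolding an poly by simp
    also have "\<dots> = integral {0..1} (\<lambda>x. D x * D x - D x * ?g x)"
      by (rule Henstock_Kurzweil_Integration.integral_diff[symmetric]) (intro D_int cont gc)+
    also have "\<dots> \<le> integral {0..1} (\<lambda>x::real. e)"
    proof (rule integral_le)
      show "(\<lambda>x. D x * D x - D x * ?g x) integrable_on {0..1}"
        by (intro Henstock_Kurzweil_Integration.integrable_diff D_int cont gc)
      fix x :: real assume x: "x \<in> {0..1}"
      have "D x * D x - D x * ?g x \<le> \<bar>D x * (D x - ?g x)\<bar>"
        by (simp add: algebra_simps)
      also have "\<dots> = \<bar>D x\<bar> * \<bar>h (cos (2 * pi * x)) - ?g x\<bar>"
        by (simp add: h_cos[OF x] abs_mult)
      also have "\<dots> \<le> C * (e / C)"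
        using C(1)[OF x] C(2) g(2)[of "cos (2 * pi * x)"] by (intro mult_mono) (auto simp: less_imp_le)
      also have "\<dots> = e" using C by simp
      finally show "D x * D x - D x * ?g x \<le> e" .
    qed auto
    finally show ?thesis by simp
  qed
  have "integral {0..1} (\<lambda>x. D x * D x) \<le> 0"
    by (rule field_le_epsilon) (use small in simp)
  moreover have "integral {0..1} (\<lambda>x. D x * D x) \<ge> 0"
    by (rule Henstock_Kurzweil_Integration.integral_nonneg) (auto intro: D_int cont)
  ultimately have "integral {0..1} (\<lambda>x. D x * D x) = 0" by simp
  hence "\<forall>x\<in>{0..1}. D x * D x = 0"
    by (subst (asm) integral_eq_0_iff) (auto intro!: continuous_intros cont)
  thus ?thesis using x by auto
qed

lemma integral_cos_2pi:
  "((\<lambda>x. cos (2 * pi * of_int n * x)) has_integral (if n = 0 then 1 else 0)) {0..1}"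
proof (cases "n = 0")
  case True
  thus ?thesis using has_integral_const_real[of "1::real" 0 1] by simp
next
  case False
  have "((\<lambda>x. cos (2 * pi * of_int n * x)) has_integral
      (sin (2 * pi * of_int n * 1) / (2 * pi * of_int n) - sin (2 * pi * of_int n * 0) / (2 * pi * of_int n))) {0..1}"
    using False
    by (intro fundamental_theorem_of_calculus)
       (auto simp: has_real_derivative_iff_has_vector_derivative[symmetric] intro!: derivative_eq_intros)
  moreover have "sin (2 * pi * of_int n) = 0"
    using sin_integer_2pi[of "of_int n"] by (simp add: mult_ac)
  ultimately show ?thesis using False by simp
qed

lemma integral_cos_cos_2pi:
  "((\<lambda>x. cos (2 * pi * real (Suc m) * x) * cos (2 * pi * real j * x)) has_integral (if j = Suc m then 1 / 2 else 0)) {0..1}"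
proof -
  let ?c = "\<lambda>n::int. \<lambda>x. cos (2 * pi * of_int n * x)"
  have "((\<lambda>x. (?c (int (Suc m) - int j) x + ?c (int (Suc m) + int j) x) / 2) has_integral
      ((if int (Suc m) - int j = 0 then 1 else 0) + (if int (Suc m) + int j = 0 then 1 else 0)) / 2) {0..1}"
    by (intro has_integral_divide has_integral_add integral_cos_2pi)
  moreover have "cos (2 * pi * real (Suc m) * x) * cos (2 * pi * real j * x)
      = (?c (int (Suc m) - int j) x + ?c (int (Suc m) + int j) x) / 2" for x
  proof -
    have "2 * pi * of_int (int (Suc m) - int j) * x = 2 * pi * real (Suc m) * x - 2 * pi * real j * x"
         "2 * pi * of_int (int (Suc m) + int j) * x = 2 * pi * real (Suc m) * x + 2 * pi * real j * x"
      by (simp_all add: algebra_simps)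
    thus ?thesis by (simp only: cos_times_cos)
  qed
  moreover have "((if int (Suc m) - int j = 0 then 1 else 0) + (if int (Suc m) + int j = 0 then 1 else 0)) / 2
      = (if j = Suc m then 1 / 2 else 0 :: real)"
    by auto
  ultimately show ?thesis by (simp only:)
qed

text \<open>The periodized Gaussian minus its expected cosine series is a continuous function
  \<open>D\<close> all of whose cosine coefficients vanish, hence \<open>D = 0\<close>; no pointwise
  convergence theorem for Fourier series is involved. At \<open>x = 1 / 2\<close> the translates sit
  at the half-integers and the cosines become alternating signs.\<close>

theorem poisson_gauss_half:
  fixes s :: real
  assumes s: "s > 0"
  shows "\<exists>A. (\<lambda>m. 2 * exp (- pi * s * (real m + 1 / 2)\<^sup>2)) sums A \<and>
             (\<lambda>k. 2 * (-1) ^ Suc k * exp (- pi * (real (Suc k))\<^sup>2 / s)) sums (sqrt s * A - 1)"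
proof -
  define G where "G = (\<lambda>y::real. exp (- pi * s * y\<^sup>2))"
  \<comment> \<open>Pairing the translates by \<open>m\<close> and \<open>- (m + 1)\<close> makes
    each term symmetric under \<open>x\<close> to \<open>1 - x\<close>; on the unit interval both
    arguments have modulus at least \<open>m\<close>, which gives the geometric majorant.\<close>
  define g where "g = (\<lambda>m::nat. \<lambda>x. G (x + real m) + G (x - real (Suc m)))"
  define e where "e = (\<lambda>m::nat. 2 * exp (- pi * (real (Suc m))\<^sup>2 / s) / sqrt s)"
  define k where "k = (\<lambda>m::nat. \<lambda>x. e m * cos (2 * pi * real (Suc m) * x))"
  define d where "d = (\<lambda>m x. g m x - k m x)"
  define M where "M = (\<lambda>m::nat. 2 * exp (- pi * s) ^ m + 2 / sqrt s * exp (- pi / s) ^ m)"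
  have sq: "real m \<le> (real m)\<^sup>2" for m
    by (cases m) (auto simp: power2_eq_square)
  have G_le: "G y \<le> exp (- pi * s) ^ m" if "\<bar>y\<bar> \<ge> real m" for y m
  proof -
    have "(real m)\<^sup>2 \<le> y\<^sup>2"
      using that by (intro abs_le_square_iff[THEN iffD1]) simp
    hence "real m \<le> y\<^sup>2"
      using sq[of m] by linarith
    hence "pi * s * real m \<le> pi * s * y\<^sup>2"
      using s by (intro mult_left_mono) auto
    thus ?thesis
      by (simp add: G_def exp_of_nat_mult[symmetric] mult_ac)
  qed
  have g_le: "\<bar>g m x\<bar> \<le> 2 * exp (- pi * s) ^ m" if "x \<in> {0..1}" for m x
  proof -
    have "G (x + real m) \<le> exp (- pi * s) ^ m" "G (x - real (Suc m)) \<le> exp (- pi * s) ^ m"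
      using that by (intro G_le; auto)+
    moreover have "G (x + real m) > 0" "G (x - real (Suc m)) > 0"
      by (simp_all add: G_def)
    ultimately show ?thesis
      unfolding g_def by linarith
  qed
  have e_le: "0 \<le> e m" "e m \<le> 2 / sqrt s * exp (- pi / s) ^ m" for m
  proof -
    have "real m \<le> (real (Suc m))\<^sup>2"
      using sq[of "Suc m"] by linarith
    hence "pi / s * real m \<le> pi / s * (real (Suc m))\<^sup>2"
      using s by (intro mult_left_mono) auto
    hence "exp (- pi * (real (Suc m))\<^sup>2 / s) \<le> exp (- pi / s) ^ m"
      by (simp add: exp_of_nat_mult[symmetric] mult_ac)
    thus "e m \<le> 2 / sqrt s * exp (- pi / s) ^ m" "0 \<le> e m"
      using s by (simp_all add: e_def divide_right_mono)
  qed
  have k_le: "\<bar>k m x\<bar> \<le> 2 / sqrt s * exp (- pi / s) ^ m" for m x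
  proof -
    have "\<bar>k m x\<bar> \<le> e m"
      using e_le(1)[of m] by (simp add: k_def abs_mult mult_left_le)
    thus ?thesis using e_le(2)[of m] by simp
  qed
  have d_le: "\<bar>d m x\<bar> \<le> M m" if "x \<in> {0..1}" for m x
    using g_le[OF that, of m] k_le[of m x] unfolding d_def M_def by linarith
  have M: "summable M"
    unfolding M_def using s by (intro summable_add summable_mult summable_geometric) auto
  have G_cont: "continuous_on A G" for A
    unfolding G_def by (intro continuous_intros)
  have d_cont: "continuous_on A (d m)" for A m
    unfolding d_def g_def k_def by (intro continuous_intros continuous_on_compose2[OF G_cont[of UNIV]]) auto
  \<comment> \<open>\<open>1 / sqrt s\<close> is the constant Fourier coefficient;
    \<open>k m\<close> carries the frequency \<open>m + 1\<close>.\<close>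
  define D where "D = (\<lambda>x. (\<Sum>m. d m x) - 1 / sqrt s)"
  have d_summable: "summable (\<lambda>m. d m x)" if "x \<in> {0..1}" for x
    by (rule summable_comparison_test'[OF M, of 0]) (use d_le[OF that] in auto)

  have "D (1 / 2) = 0"
  proof (rule cos_coeffs_zero_imp_zero[where D = D])
    have "uniform_limit {0..1} (\<lambda>N x. \<Sum>m<N. d m x) (\<lambda>x. \<Sum>m. d m x) sequentially"
      by (rule Weierstrass_m_test[OF _ M]) (use d_le in auto)
    hence "continuous_on {0..1} (\<lambda>x. \<Sum>m. d m x)"
      by (rule uniform_limit_theorem[rotated]) (auto intro!: always_eventually continuous_intros d_cont)
    thus "continuous_on {0..1} D"
      unfolding D_def by (intro continuous_intros)
  next
    fix x :: real assume "x \<in> {0..1}"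
    have "d m (1 - x) = d m x" for m
    proof -
      have G_even: "G (- y) = G y" for y
        by (simp add: G_def)
      have "cos (2 * pi * real (Suc m) * (1 - x)) = cos (2 * pi * real (Suc m) - 2 * pi * real (Suc m) * x)"
        by (simp add: algebra_simps)
      also have "\<dots> = cos (2 * pi * real (Suc m) * x)"
        using cos_integer_2pi[of "real (Suc m)"] sin_integer_2pi[of "real (Suc m)"]
        by (simp add: cos_diff mult_ac del: of_nat_Suc)
      finally have "k m (1 - x) = k m x"
        by (simp add: k_def)
      moreover have "g m (1 - x) = g m x"
        using G_even[of "x - real (Suc m)"] G_even[of "x + real m"]
        by (simp add: g_def algebra_simps)
      ultimately show ?thesis by (simp add: d_def)
    qed
    thus "D (1 - x) = D x" by (simp add: D_def)
  next
    fix j :: nat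
    define c where "c = (\<lambda>x. cos (2 * pi * real j * x))"
    \<comment> \<open>Unfolding: integrating the first \<open>N\<close> pairs of translates over the
      unit interval against the periodic \<open>c\<close> telescopes to one integral over
      \<open>{-real N..real N}\<close>, which tends to the Fourier transform
      \<open>L\<close>.\<close>
    define A where "A = (\<lambda>N::nat. integral {-real N..real N} (\<lambda>y. G y * c y))"
    have c_le: "\<bar>c x\<bar> \<le> 1" for x by (simp add: c_def)
    have c_cont: "continuous_on B c" for B
      unfolding c_def by (intro continuous_intros)
    have Gc_int: "(\<lambda>y. G y * c y) integrable_on {a..b}" for a b
      by (intro integrable_continuous_real continuous_intros G_cont c_cont)
    have c_shift: "c (x + of_int n) = c x" for x n
    proof -
      have "c (x + of_int n) = cos (2 * pi * real j * x + 2 * pi * of_int (int j * n))"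
        by (simp add: c_def algebra_simps)
      also have "\<dots> = c x"
        using cos_integer_2pi[of "of_int (int j * n)"] sin_integer_2pi[of "of_int (int j * n)"]
        by (simp add: cos_add c_def mult_ac del: of_int_mult)
      finally show ?thesis .
    qed
    have g_int: "((\<lambda>x. g m x * c x) has_integral (A (Suc m) - A m)) {0..1}" for m
    proof -
      have shift: "((\<lambda>x. G (x + of_int n) * c x) has_integral integral {of_int n..of_int n + 1} (\<lambda>y. G y * c y)) {0..1}" for n
        using has_integral_shift_real_ivl[OF integrable_integral[OF Gc_int, of "of_int n" "of_int n + 1"], of "of_int n"]
        by (simp add: c_shift)
      have "((\<lambda>x. G (x + of_int (int m)) * c x + G (x + of_int (- int (Suc m))) * c x) has_integral
         (integral {of_int (int m)..of_int (int m) + 1} (\<lambda>y. G y * c y)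
         + integral {of_int (- int (Suc m))..of_int (- int (Suc m)) + 1} (\<lambda>y. G y * c y))) {0..1}"
        by (intro has_integral_add shift)
      moreover have "integral {of_int (int m)..of_int (int m) + 1} (\<lambda>y. G y * c y)
         + integral {of_int (- int (Suc m))..of_int (- int (Suc m)) + 1} (\<lambda>y. G y * c y) = A (Suc m) - A m"
      proof -
        have "integral {- real (Suc m)..- real m} (\<lambda>y. G y * c y) + integral {- real m..real (Suc m)} (\<lambda>y. G y * c y) = A (Suc m)"
          unfolding A_def by (rule Henstock_Kurzweil_Integration.integral_combine) (auto intro: Gc_int)
        moreover have "A m + integral {real m..real (Suc m)} (\<lambda>y. G y * c y) = integral {- real m..real (Suc m)} (\<lambda>y. G y * c y)"
          unfolding A_def by (rule Henstock_Kurzweil_Integration.integral_combine) (auto intro: Gc_int)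
        ultimately show ?thesis by (simp add: add_ac)
      qed
      ultimately have "((\<lambda>x. G (x + of_int (int m)) * c x + G (x + of_int (- int (Suc m))) * c x) has_integral
         (A (Suc m) - A m)) {0..1}"
        by (simp only:)
      moreover have "x + of_int (- int (Suc m)) = x - real (Suc m)" for x
        by simp
      ultimately show ?thesis
        by (simp only: g_def distrib_right of_int_of_nat_eq)
    qed
    have k_int: "((\<lambda>x. k m x * c x) has_integral (e m * (if j = Suc m then 1 / 2 else 0))) {0..1}" for m
      unfolding k_def c_def mult.assoc[of "e m"] by (intro has_integral_mult_right integral_cos_cos_2pi)
    define b where "b = (\<lambda>N. \<Sum>m<N. e m * (if j = Suc m then 1 / 2 else 0))"
    have part_int: "((\<lambda>x. \<Sum>m<N. d m x * c x) has_integral (A N - b N)) {0..1}" for N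
    proof -
      have "((\<lambda>x. \<Sum>m<N. g m x * c x - k m x * c x) has_integral
          (\<Sum>m<N. (A (Suc m) - A m) - e m * (if j = Suc m then 1 / 2 else 0))) {0..1}"
        by (intro has_integral_sum has_integral_diff g_int k_int) auto
      moreover have "(\<Sum>m<N. (A (Suc m) - A m) - e m * (if j = Suc m then 1 / 2 else 0)) = A N - b N"
      proof -
        have "A 0 = 0" by (simp add: A_def)
        thus ?thesis by (induction N) (simp_all add: b_def)
      qed
      ultimately show ?thesis by (simp add: d_def left_diff_distrib)
    qed
    define L where "L = exp (- pi * (real j)\<^sup>2 / s) / sqrt s"
    have A_lim: "A \<longlonglongrightarrow> L"
    proof -
      define f where "f = (\<lambda>N::nat. \<lambda>y. if y \<in> {-real N..real N} then G y * c y else 0)"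
      have "(\<lambda>N. integral UNIV (f N)) \<longlonglongrightarrow> integral UNIV (\<lambda>y. G y * c y)"
      proof (rule dominated_convergence(2))
        show "f N integrable_on UNIV" for N
          unfolding f_def integrable_restrict_UNIV by (rule Gc_int)
        show "G integrable_on UNIV"
          using gauss_cos_integral(2)[OF s] by (simp only: G_def)
        show "norm (f N y) \<le> G y" for N y
          using c_le[of y] by (auto simp: f_def G_def abs_mult mult_left_le)
        show "(\<lambda>N. f N y) \<longlonglongrightarrow> G y * c y" for y
        proof (rule tendsto_eventually, rule eventually_sequentiallyI)
          fix N assume "nat \<lceil>\<bar>y\<bar>\<rceil> \<le> N"
          hence "\<bar>y\<bar> \<le> real N" by linarith
          thus "f N y = G y * c y" by (auto simp: f_def)
        qed
      qed
      moreover have "integral UNIV (f N) = A N" for N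
        unfolding f_def A_def by (rule integral_restrict_UNIV)
      moreover have "integral UNIV (\<lambda>y. G y * c y) = L"
        using gauss_cos_integral(1)[OF s, of "real j"] unfolding G_def c_def L_def by (rule integral_unique)
      ultimately show ?thesis by simp
    qed
    \<comment> \<open>Only the term \<open>m = j - 1\<close> has a nonzero coefficient. For
      \<open>j = 0\<close> there is none, and \<open>L\<close> is cancelled later by the constant
      \<open>1 / sqrt s\<close>.\<close>
    have b_lim: "b \<longlonglongrightarrow> (if j = 0 then 0 else L)"
    proof (rule tendsto_eventually, rule eventually_sequentiallyI[of j])
      fix N assume "j \<le> N"
      show "b N = (if j = 0 then 0 else L)"
      proof (cases j)
        case (Suc i)
        have "b N = (\<Sum>m<N. if m = i then e m / 2 else 0)"
          unfolding b_def by (rule sum.cong) (auto simp: Suc)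
        also have "\<dots> = e i / 2"
          using \<open>j \<le> N\<close> Suc by simp
        finally show ?thesis by (simp add: Suc e_def L_def)
      qed (simp add: b_def)
    qed
    have "uniform_limit {0..1} (\<lambda>N x. \<Sum>m<N. d m x * c x) (\<lambda>x. \<Sum>m. d m x * c x) sequentially"
    proof (rule Weierstrass_m_test[OF _ M])
      fix m and x :: real assume "x \<in> {0..1}"
      have "\<bar>d m x\<bar> * \<bar>c x\<bar> \<le> M m * 1"
        using d_le[OF \<open>x \<in> {0..1}\<close>, of m] c_le[of x] by (intro mult_mono) auto
      thus "norm (d m x * c x) \<le> M m" by (simp add: abs_mult)
    qed
    then obtain I J where IJ: "\<And>N. ((\<lambda>x. \<Sum>m<N. d m x * c x) has_integral I N) {0..1}"
       "((\<lambda>x. \<Sum>m. d m x * c x) has_integral J) {0..1}" "I \<longlonglongrightarrow> J"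
      by (rule uniform_limit_integral) (auto intro!: continuous_intros d_cont c_cont)
    have "I = (\<lambda>N. A N - b N)"
      using has_integral_unique[OF IJ(1) part_int] by blast
    hence "I \<longlonglongrightarrow> L - (if j = 0 then 0 else L)"
      using tendsto_diff[OF A_lim b_lim] by simp
    hence J: "J = L - (if j = 0 then 0 else L)"
      using IJ(3) LIMSEQ_unique by blast
    have "((\<lambda>x. (\<Sum>m. d m x * c x) - 1 / sqrt s * c x) has_integral (J - 1 / sqrt s * (if int j = 0 then 1 else 0))) {0..1}"
      using integral_cos_2pi[of "int j"] unfolding c_def[symmetric]
      by (intro has_integral_diff IJ(2) has_integral_mult_right) (simp add: c_def)
    moreover have "J - 1 / sqrt s * (if int j = 0 then 1 else 0) = 0"
      by (simp add: J L_def)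
    moreover have "(\<Sum>m. d m x * c x) - 1 / sqrt s * c x = D x * c x" if "x \<in> {0..1}" for x
      using suminf_mult2[OF d_summable[OF that], of "c x"] by (simp add: D_def left_diff_distrib)
    ultimately have "((\<lambda>x. D x * c x) has_integral 0) {0..1}"
      by (metis (no_types, lifting) has_integral_cong)
    thus "integral {0..1} (\<lambda>x. D x * cos (2 * pi * real j * x)) = 0"
      by (simp add: c_def integral_unique)
  qed auto

  have g_half: "g m (1 / 2) = 2 * exp (- pi * s * (real m + 1 / 2)\<^sup>2)" for m
    by (simp add: g_def G_def power2_eq_square algebra_simps)
  have k_half: "k m (1 / 2) = (2 * (-1) ^ Suc m * exp (- pi * (real (Suc m))\<^sup>2 / s)) / sqrt s" for m
  proof -
    have "2 * pi * real (Suc m) * (1 / 2) = real (Suc m) * pi"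
      by simp
    hence "cos (2 * pi * real (Suc m) * (1 / 2)) = (-1) ^ Suc m"
      by (simp only: cos_npi)
    thus ?thesis by (simp add: k_def e_def)
  qed
  have g_sums: "summable (\<lambda>m. g m (1 / 2))"
    by (rule summable_comparison_test'[of "\<lambda>m. 2 * exp (- pi * s) ^ m" 0])
       (use g_le[of "1/2"] s in \<open>auto intro!: summable_mult summable_geometric\<close>)
  have k_sums: "summable (\<lambda>m. k m (1 / 2))"
    by (rule summable_comparison_test'[of "\<lambda>m. 2 / sqrt s * exp (- pi / s) ^ m" 0])
       (use k_le[of _ "1/2"] s in \<open>auto intro!: summable_mult summable_geometric\<close>)
  define A where "A = (\<Sum>m. g m (1 / 2))"
  have "A - (\<Sum>m. k m (1 / 2)) = 1 / sqrt s"
    using \<open>D (1 / 2) = 0\<close> suminf_diff[OF g_sums k_sums] by (simp add: D_def A_def d_def)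
  hence k_sum: "(\<Sum>m. k m (1 / 2)) * sqrt s = sqrt s * A - 1"
    using s by (simp add: field_simps)
  have "(\<lambda>m. k m (1 / 2) * sqrt s) sums (sqrt s * A - 1)"
    using sums_mult2[OF summable_sums[OF k_sums], of "sqrt s"] unfolding k_sum .
  moreover have "(\<lambda>m. g m (1 / 2)) sums A"
    using g_sums by (simp add: A_def summable_sums)
  ultimately show ?thesis
    using s by (intro exI[of _ A]) (simp add: g_half k_half)
qed

section \<open>The inversion formula on the imaginary axis\<close>

text \<open>Two-sided form. The reflection of \<open>n\<close> to \<open>- 1 - n\<close> preserves
  \<open>(n + 1 / 2)^2\<close>, so the first sum has two equal halves; in the alternating sum the
  term at 0 stands alone, which accounts for the \<open>- 1\<close> in
  \<open>poisson_gauss_half\<close>.\<close>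

lemma poisson_gauss:
  fixes s :: real
  assumes s: "s > 0"
  obtains A where "((\<lambda>n::int. exp (- pi * s * (of_int n + 1 / 2)\<^sup>2)) has_sum A) UNIV"
    and "((\<lambda>n::int. (-1) powi n * exp (- pi * (of_int n)\<^sup>2 / s)) has_sum (sqrt s * A)) UNIV"
proof -
  obtain A where A: "(\<lambda>m. 2 * exp (- pi * s * (real m + 1 / 2)\<^sup>2)) sums A"
     and B: "(\<lambda>k. 2 * (-1) ^ Suc k * exp (- pi * (real (Suc k))\<^sup>2 / s)) sums (sqrt s * A - 1)"
    using poisson_gauss_half[OF s] by blast
  have "(\<lambda>m. exp (- pi * s * (real m + 1 / 2)\<^sup>2)) sums (A / 2)"
    using sums_divide[OF A, of 2] by simp
  hence hs: "((\<lambda>m. exp (- pi * s * (real m + 1 / 2)\<^sup>2)) has_sum (A / 2)) UNIV"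
    by (rule sums_nonneg_imp_has_sum) auto
  have 1: "((\<lambda>n::int. exp (- pi * s * (of_int n + 1 / 2)\<^sup>2)) has_sum (A / 2 + A / 2)) UNIV"
  proof (rule has_sum_int_split)
    have "(of_int (- 1 - int n) + 1 / 2)\<^sup>2 = (real n + 1 / 2)\<^sup>2" for n
      by (simp add: power2_eq_square algebra_simps)
    thus "((\<lambda>n. exp (- pi * s * (of_int (- 1 - int n) + 1 / 2)\<^sup>2)) has_sum (A / 2)) UNIV"
      using hs by (simp only:)
  qed (use hs in simp)
  define h where "h = (\<lambda>m. (-1) ^ m * exp (- pi * (real m)\<^sup>2 / s))"
  have "summable (\<lambda>m. exp (- pi / s) ^ (m * m) * 1 ^ m)"
    using s by (intro summable_gauss) auto
  moreover have "norm (h m) = exp (- pi / s) ^ (m * m) * 1 ^ m" for m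
    by (simp add: h_def abs_mult power_abs exp_of_nat_mult[symmetric] power2_eq_square mult_ac)
  ultimately have norm_h: "summable (\<lambda>m. norm (h m))"
    by simp
  have B': "(\<lambda>k. h (Suc k)) sums ((sqrt s * A - 1) / 2)"
    using sums_divide[OF B, of 2] by (simp add: h_def)
  have "h sums ((sqrt s * A - 1) / 2 + h 0)"
    by (rule sums_Suc[OF B'])
  hence "(h has_sum ((sqrt s * A - 1) / 2 + 1)) UNIV"
    by (intro norm_summable_imp_has_sum norm_h) (simp add: h_def)
  moreover have "((\<lambda>k. h (Suc k)) has_sum ((sqrt s * A - 1) / 2)) UNIV"
    using summable_Suc_iff[of "\<lambda>m. norm (h m)"] norm_h by (intro norm_summable_imp_has_sum B') simp
  moreover have "(-1) powi (int n) * exp (- pi * (of_int (int n))\<^sup>2 / s) = h n" for n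
    by (simp add: h_def)
  moreover have "(-1) powi (- 1 - int n) * exp (- pi * (of_int (- 1 - int n))\<^sup>2 / s) = h (Suc n)" for n
  proof -
    have "- 1 - int n = - int (Suc n)"
      by simp
    thus ?thesis
      by (simp only: power_int_minus_one_minus power_int_of_nat of_int_minus power2_minus of_int_of_nat_eq h_def)
  qed
  ultimately have "((\<lambda>n::int. (-1) powi n * exp (- pi * (of_int n)\<^sup>2 / s)) has_sum
      ((sqrt s * A - 1) / 2 + 1 + (sqrt s * A - 1) / 2)) UNIV"
    by (intro has_sum_int_split) simp_all
  hence 2: "((\<lambda>n::int. (-1) powi n * exp (- pi * (of_int n)\<^sup>2 / s)) has_sum (sqrt s * A)) UNIV"
    by simp
  from that 1 2 show ?thesis by simp
qed

lemma cubic_cf_prodinf: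
  assumes q: "0 < q" "q < 1"
  shows "cubic_cf q = q powr (1 / 3) * ((\<Prod>n. 1 - q ^ (6*n+1)) * (\<Prod>n. 1 - q ^ (6*n+5)) / (\<Prod>n. 1 - q ^ (6*n+3))\<^sup>2)"
proof -
  have conv: "convergent_prod (\<lambda>n. 1 - q ^ (6*n+k))" for k
    using convergent_prod_linear_power(2)[OF q, of 6 1 k] by simp
  have "(\<Prod>n. 1 - q ^ (6*n+1)) * (\<Prod>n. 1 - q ^ (6*n+5)) / (\<Prod>n. 1 - q ^ (6*n+3))\<^sup>2
     = (\<Prod>n. (1 - q ^ (6*n+1)) * (1 - q ^ (6*n+5))) / (\<Prod>n. (1 - q ^ (6*n+3))\<^sup>2)"
    by (simp only: prodinf_mult[OF conv conv] prodinf_power[OF conv])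
  also have "\<dots> = (\<Prod>n. (1 - q ^ (6*n+1)) * (1 - q ^ (6*n+5)) / (1 - q ^ (6*n+3))\<^sup>2)"
    by (intro prodinf_divide convergent_prod_mult convergent_prod_power conv)
  finally show ?thesis
    by (simp add: cubic_cf_def)
qed

text \<open>Splitting the series of \<open>(- 1) ^ n * q powr (n\<^sup>2 / 3)\<close> according to \<open>n mod 3\<close> gives the denominator
  of the continued fraction minus twice its numerator, both written as theta series.\<close>

lemma one_minus_2_cubic_cf:
  fixes t :: real
  assumes t: "t > 0"
  obtains B where "B > 0" "((\<lambda>m::int. (-1) powi m * exp (- 6 * pi * t * (of_int m)\<^sup>2)) has_sum B) UNIV"
    "((\<lambda>m::int. (-1) powi m * exp (- 2 * pi * t * (of_int m)\<^sup>2 / 3)) has_sum (1 - 2 * cubic_cf (exp (- 2 * pi * t))) * B) UNIV"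
proof -
  define q where "q = exp (- 2 * pi * t)"
  have q: "0 < q" "q < 1"
    using t by (simp_all add: q_def)
  define x where "x = exp (- 6 * pi * t)"
  have x: "0 < x" "x < 1" "x = q ^ 3"
    using t by (simp_all add: x_def q_def exp_of_nat_mult[symmetric])
  have xq: "x ^ k = q ^ (3 * k)" for k
    by (simp add: x power_mult)
  let ?P = "\<lambda>k. \<Prod>n. 1 - q ^ (6 * n + k)"
  have P: "?P k > 0" if "k > 0" for k
    using prodinf_linear_power_pos[OF q, of 6 k] that by simp
  have fac: "(\<Prod>n. 1 - x ^ (2*n+2)) = ?P 6" "(\<Prod>n. 1 - x ^ (2*n+1)) = ?P 3"
    unfolding xq by (simp_all add: algebra_simps)
  define B where "B = ?P 6 * (?P 3)\<^sup>2"
  define A where "A = ?P 6 * (?P 5 * ?P 1)"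
  have "B > 0"
    using P[of 6] P[of 3] by (simp add: B_def)
  have B: "((\<lambda>m::int. (-1) powi m * exp (- 6 * pi * t * (of_int m)\<^sup>2)) has_sum B) UNIV"
  proof -
    have "((\<lambda>m::int. x powi (m * m) * (-1) powi m) has_sum B) UNIV"
    proof -
      have e: "1 + (- 1) * y = 1 - y" "1 + y / (- 1) = 1 - y" "(-1 :: real) \<noteq> 0" for y :: real
        by simp_all
      show ?thesis
        using jacobi_triple_product[OF x(1,2) e(3)] unfolding e(1,2) fac B_def power2_eq_square .
    qed
    moreover have "x powi (m * m) * (-1) powi m = (-1) powi m * exp (- 6 * pi * t * (of_int m)\<^sup>2)" for m
      by (simp add: x_def exp_power_int power2_eq_square mult_ac)
    ultimately show ?thesis by (simp only:)
  qed
  \<comment> \<open>As \<open>(3 * m + 1)^2 / 3 = 3 * m^2 + 2 * m + 1 / 3\<close>, these are the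
    terms with index \<open>3 * m + 1\<close> up to sign and the factor
    \<open>q powr (1 / 3)\<close>; they form the theta series of the triple product at
    \<open>z = - q^2\<close>.\<close>
  define a where "a = (\<lambda>m::int. (-1) powi m * exp (- 2 * pi * t * (3 * (of_int m)\<^sup>2 + 2 * of_int m)))"
  have A: "(a has_sum A) UNIV"
  proof -
    have e1: "1 + x ^ (2*n+1) / (- (q\<^sup>2)) = 1 - q ^ (6*n+1)" for n
    proof -
      have "x ^ (2*n+1) = q ^ (6*n+1) * q ^ 2"
        unfolding xq power_add[symmetric] by (rule arg_cong[of _ _ "power q"]) simp
      thus ?thesis using q by simp
    qed
    have e2: "1 + - (q\<^sup>2) * x ^ (2*n+1) = 1 - q ^ (6*n+5)" for n
    proof -
      have "q ^ (6*n+5) = q\<^sup>2 * x ^ (2*n+1)"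
        unfolding xq power_add[symmetric] by (rule arg_cong[of _ _ "power q"]) simp
      thus ?thesis by simp
    qed
    have "- (q\<^sup>2) \<noteq> 0"
      using q by simp
    hence "((\<lambda>m::int. x powi (m * m) * (- (q\<^sup>2)) powi m) has_sum A) UNIV"
      using jacobi_triple_product[OF x(1,2), of "- (q\<^sup>2)"] unfolding e1 e2 fac A_def by (simp only: simp_thms)
    moreover have "x powi (m * m) * (- (q\<^sup>2)) powi m = a m" for m
    proof -
      have "(- (q\<^sup>2)) powi m = (-1) powi m * (q\<^sup>2) powi m"
        using power_int_mult_distrib[of "-1" "q\<^sup>2" m] by simp
      moreover have "q\<^sup>2 = exp (- 4 * pi * t)"
        by (simp add: q_def exp_of_nat_mult[symmetric])
      ultimately have "x powi (m * m) * (- (q\<^sup>2)) powi m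
          = (-1) powi m * (exp (- 6 * pi * t * of_int (m * m)) * exp (- 4 * pi * t * of_int m))"
        by (simp add: x_def exp_power_int mult_ac)
      also have "exp (- 6 * pi * t * of_int (m * m)) * exp (- 4 * pi * t * of_int m)
          = exp (- 2 * pi * t * (3 * (of_int m)\<^sup>2 + 2 * of_int m))"
        unfolding exp_add[symmetric] by (rule arg_cong[of _ _ exp]) (simp add: power2_eq_square algebra_simps)
      finally show ?thesis by (simp only: a_def)
    qed
    ultimately show ?thesis by (simp only:)
  qed
  define c where "c = exp (- 2 * pi * t / 3)"
  have cq: "c = q powr (1 / 3)"
    by (simp add: c_def q_def powr_def)
  have V: "cubic_cf q * B = c * A"
    using P[of 3] by (simp add: cubic_cf_prodinf[OF q] cq A_def B_def)
  define f where "f = (\<lambda>m::int. (-1) powi m * exp (- 2 * pi * t * (of_int m)\<^sup>2 / 3))"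
  have odd: "(-1) powi (3 * m + 1) = - ((-1 :: real) powi m)" for m :: int
    by (simp add: power_int_minus_left)
  have "(f has_sum (B + (- c * A) + (- c * A))) UNIV"
  proof (rule has_sum_int_mod3)
    have "f (3 * m) = (-1) powi m * exp (- 6 * pi * t * (of_int m)\<^sup>2)" for m
      by (simp add: f_def power_int_minus_left power_mult_distrib)
    thus "((\<lambda>m. f (3 * m)) has_sum B) UNIV"
      using B by (simp only:)
    have f1: "f (3 * m + 1) = - c * a m" for m
    proof -
      have "- 2 * pi * t * (of_int (3 * m + 1))\<^sup>2 / 3 = - 2 * pi * t / 3 + - 2 * pi * t * (3 * (of_int m)\<^sup>2 + 2 * of_int m)"
        by (simp add: power2_eq_square field_simps)
      hence "exp (- 2 * pi * t * (of_int (3 * m + 1))\<^sup>2 / 3) = c * exp (- 2 * pi * t * (3 * (of_int m)\<^sup>2 + 2 * of_int m))"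
        by (simp only: c_def exp_add)
      thus ?thesis
        by (simp add: f_def a_def odd)
    qed
    have f1s: "((\<lambda>m. f (3 * m + 1)) has_sum (- c * A)) UNIV"
      unfolding f1 by (rule has_sum_cmult_right[OF A])
    thus "((\<lambda>m. f (3 * m + 1)) has_sum (- c * A)) UNIV" .
    have "f (3 * m - 1) = f (3 * (- m) + 1)" for m
    proof -
      have "3 * m - 1 = - (3 * (- m) + 1)" by simp
      thus ?thesis
        by (simp only: f_def power_int_minus_one_minus of_int_minus power2_minus)
    qed
    moreover have "((\<lambda>m. f (3 * (- m) + 1)) has_sum (- c * A)) UNIV"
      by (subst has_sum_reindex_bij_witness[where i = uminus and j = uminus and T = UNIV, OF _ _ _ _ _ refl])
         (use f1s in auto)
    ultimately show "((\<lambda>m. f (3 * m - 1)) has_sum (- c * A)) UNIV"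
      by (simp only:)
  qed
  moreover have "B + (- c * A) + (- c * A) = (1 - 2 * cubic_cf q) * B"
    using V by (simp add: algebra_simps)
  ultimately have "(f has_sum ((1 - 2 * cubic_cf q) * B)) UNIV"
    by (simp only:)
  from that[OF \<open>B > 0\<close> B this[unfolded f_def q_def]] show ?thesis .
qed

text \<open>The 3-dissection of the half-integer theta series, which Poisson summation exchanges
  with the series of \<open>one_minus_2_cubic_cf\<close>. Indices \<open>3 * m + 1\<close> give the
  same series with \<open>t / 3\<close> replaced by \<open>3 * t\<close>, which is \<open>S\<close>;
  the other two residue classes are mirror images and together contribute
  \<open>S / cubic_cf q\<close> by Euler's identities.\<close>

lemma one_plus_inverse_cubic_cf:
  fixes t :: real
  assumes t: "t > 0"
  obtains S where "S > 0" "((\<lambda>n::int. exp (- pi * (3 * t) * (of_int n + 1 / 2)\<^sup>2)) has_sum S) UNIV"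
    "((\<lambda>n::int. exp (- pi * (t / 3) * (of_int n + 1 / 2)\<^sup>2)) has_sum (1 + 1 / cubic_cf (exp (- 2 * pi * t))) * S) UNIV"
proof -
  define q where "q = exp (- 2 * pi * t)"
  have q: "0 < q" "q < 1"
    using t by (simp_all add: q_def)
  define x where "x = exp (- 3 * pi * t)"
  have x: "0 < x" "x < 1"
    using t by (simp_all add: x_def)
  have xq: "x ^ 2 = q ^ 3"
    by (simp add: x_def q_def exp_of_nat_mult[symmetric])
  have x2: "x ^ (2 * k) = q ^ (3 * k)" for k
    by (simp only: power_mult xq)
  define r p1 p2 p3 where "r = (\<Prod>n. 1 - q ^ (3*n+3))" and "p1 = (\<Prod>n. 1 + q ^ (3*n+1))"
    and "p2 = (\<Prod>n. 1 + q ^ (3*n+2))" and "p3 = (\<Prod>n. 1 + q ^ (3*n+3))"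
  have r: "r > 0"
    using prodinf_linear_power_pos[OF q, of 3 3] by (simp add: r_def)
  have fac: "(\<Prod>n. 1 - x ^ (2*n+2)) = r"
  proof -
    have "x ^ (2*n+2) = q ^ (3*n+3)" for n
      using x2[of "n + 1"] by (simp only: distrib_left mult_1_right)
    thus ?thesis by (simp add: r_def)
  qed
  define S where "S = exp (- 3 * pi * t / 4) * (2 * r * p3\<^sup>2)"
  have p3: "p3 > 0"
  proof -
    have "p3 * (\<Prod>n. 1 - q ^ (6*n+3)) = 1"
      unfolding p3_def by (rule euler_mod6(1)[OF q])
    hence "0 < p3 * (\<Prod>n. 1 - q ^ (6*n+3))"
      by simp
    thus ?thesis
      by (rule zero_less_mult_pos2) (rule prodinf_linear_power_pos[OF q]; simp)
  qed
  have "S > 0"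
    using r p3 by (simp add: S_def)
  have S: "((\<lambda>n::int. exp (- pi * (3 * t) * (of_int n + 1 / 2)\<^sup>2)) has_sum S) UNIV"
  proof -
    have e1: "x * x ^ (2*n+1) = q ^ (3*n+3)" for n
    proof -
      have "Suc (2*n+1) = 2 * (n + 1)" "3*n+3 = 3 * (n + 1)"
        by simp_all
      thus ?thesis
        by (simp only: power_Suc[symmetric] x2)
    qed
    have e2: "x ^ (2*n+1) / x = q ^ (3*n)" for n
      using x by (simp add: x2)
    \<comment> \<open>The factor at \<open>n = 0\<close> is 2, the origin of the 2 in
      \<open>S\<close>; it matches the two equal residue classes below.\<close>
    have e3: "(\<Prod>n. 1 + q ^ (3*n)) = 2 * p3"
    proof -
      have "convergent_prod (\<lambda>n. 1 + q ^ (3*n))"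
        using convergent_prod_linear_power(1)[OF q, of 3 1 0] by simp
      moreover have "1 + q ^ (3*n) \<noteq> 0" for n
        using zero_less_power[OF q(1), of "3*n"] by linarith
      ultimately show ?thesis
        using prodinf_split_head[of "\<lambda>n. 1 + q ^ (3*n)"] by (simp add: p3_def add.commute)
    qed
    have "x \<noteq> 0"
      using x by simp
    hence "((\<lambda>m::int. x powi (m * m) * x powi m) has_sum (r * (p3 * (2 * p3)))) UNIV"
      using jacobi_triple_product[OF x, of x] unfolding e1 e2 e3 fac p3_def[symmetric] by (simp only: simp_thms)
    hence "((\<lambda>m::int. exp (- 3 * pi * t / 4) * (x powi (m * m) * x powi m)) has_sum
        (exp (- 3 * pi * t / 4) * (r * (p3 * (2 * p3))))) UNIV"
      by (rule has_sum_cmult_right)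
    moreover have "exp (- 3 * pi * t / 4) * (x powi (m * m) * x powi m) = exp (- pi * (3 * t) * (of_int m + 1 / 2)\<^sup>2)" for m
    proof -
      have "exp (- 3 * pi * t / 4) * (x powi (m * m) * x powi m)
          = exp (- 3 * pi * t / 4 + (- 3 * pi * t * of_int (m * m) + - 3 * pi * t * of_int m))"
        by (simp only: x_def exp_power_int exp_add) (simp add: mult_ac)
      also have "- 3 * pi * t / 4 + (- 3 * pi * t * of_int (m * m) + - 3 * pi * t * of_int m)
          = - pi * (3 * t) * (of_int m + 1 / 2)\<^sup>2"
        by (simp add: power2_eq_square field_simps)
      finally show ?thesis .
    qed
    ultimately show ?thesis
      by (simp only: S_def) (simp add: mult_ac power2_eq_square)
  qed
  define D where "D = r * (p2 * p1)"
  define z where "z = exp (- pi * t)"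
  define a where "a = (\<lambda>m::int. exp (- pi * t * (3 * (of_int m)\<^sup>2 + of_int m)))"
  have D: "(a has_sum D) UNIV"
  proof -
    have z2: "z ^ 2 = q"
      by (simp add: z_def q_def exp_of_nat_mult[symmetric])
    have x_z: "x = z ^ 3"
      by (simp add: z_def x_def exp_of_nat_mult[symmetric])
    have "z > 0" by (simp add: z_def)
    have qz: "q ^ k = z ^ (2 * k)" for k
      by (simp only: z2[symmetric] power_mult)
    have e1: "z * x ^ (2*n+1) = q ^ (3*n+2)" for n
      unfolding qz x_z power_mult[symmetric] power_Suc[symmetric] by (rule arg_cong[of _ _ "power z"]) simp
    have e2: "x ^ (2*n+1) / z = q ^ (3*n+1)" for n
    proof -
      have "x ^ (2*n+1) = z * q ^ (3*n+1)"
        unfolding qz x_z power_mult[symmetric] power_Suc[symmetric] by (rule arg_cong[of _ _ "power z"]) simp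
      thus ?thesis using \<open>z > 0\<close> by simp
    qed
    have "z \<noteq> 0"
      using \<open>z > 0\<close> by simp
    hence "((\<lambda>m::int. x powi (m * m) * z powi m) has_sum D) UNIV"
      using jacobi_triple_product[OF x, of z] unfolding e1 e2 fac D_def p1_def p2_def by (simp only: simp_thms)
    moreover have "x powi (m * m) * z powi m = a m" for m
    proof -
      have "x powi (m * m) * z powi m = exp (- 3 * pi * t * of_int (m * m) + - pi * t * of_int m)"
        by (simp only: x_def z_def exp_power_int exp_add) (simp add: mult_ac)
      also have "- 3 * pi * t * of_int (m * m) + - pi * t * of_int m = - pi * t * (3 * (of_int m)\<^sup>2 + of_int m)"
        by (simp add: power2_eq_square algebra_simps)
      finally show ?thesis by (simp only: a_def)
    qed
    ultimately show ?thesis by (simp only:)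
  qed
  define f where "f = (\<lambda>n::int. exp (- pi * (t / 3) * (of_int n + 1 / 2)\<^sup>2))"
  define c where "c = exp (- pi * t / 12)"
  have "(f has_sum (c * D + S + c * D)) UNIV"
  proof (rule has_sum_int_mod3)
    have f0: "f (3 * m) = c * a m" for m
      unfolding f_def c_def a_def exp_add[symmetric]
      by (rule arg_cong[of _ _ exp]) (simp add: power2_eq_square field_simps)
    have f0s: "((\<lambda>m. f (3 * m)) has_sum (c * D)) UNIV"
      unfolding f0 by (rule has_sum_cmult_right[OF D])
    thus "((\<lambda>m. f (3 * m)) has_sum (c * D)) UNIV" .
    have "f (3 * m + 1) = exp (- pi * (3 * t) * (of_int m + 1 / 2)\<^sup>2)" for m
      unfolding f_def by (rule arg_cong[of _ _ exp]) (simp add: power2_eq_square field_simps)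
    thus "((\<lambda>m. f (3 * m + 1)) has_sum S) UNIV"
      using S by (simp only:)
    have "f (3 * m - 1) = f (3 * (- m))" for m
      unfolding f_def by (rule arg_cong[of _ _ exp]) (simp add: power2_eq_square field_simps)
    moreover have "((\<lambda>m. f (3 * (- m))) has_sum (c * D)) UNIV"
      by (subst has_sum_reindex_bij_witness[where i = uminus and j = uminus and T = UNIV, OF _ _ _ _ _ refl])
         (use f0s in auto)
    ultimately show "((\<lambda>m. f (3 * m - 1)) has_sum (c * D)) UNIV"
      by (simp only:)
  qed
  moreover have "c * D + S + c * D = (1 + 1 / cubic_cf q) * S"
  proof -
    define m1 m3 m5 where "m1 = (\<Prod>n. 1 - q ^ (6*n+1))" and "m3 = (\<Prod>n. 1 - q ^ (6*n+3))"
      and "m5 = (\<Prod>n. 1 - q ^ (6*n+5))"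
    have m: "m1 > 0" "m3 > 0" "m5 > 0"
      unfolding m1_def m3_def m5_def by (rule prodinf_linear_power_pos[OF q]; simp)+
    have eul: "p3 * m3 = 1" "m1 * m5 * (p1 * p2) = 1"
      using euler_mod6[OF q] by (simp_all only: p1_def p2_def p3_def m1_def m3_def m5_def)
    define d where "d = exp (- 2 * pi * t / 3)"
    have "d = q powr (1 / 3)"
      by (simp add: d_def q_def powr_def)
    hence V: "cubic_cf q = d * (m1 * m5 / m3\<^sup>2)"
      by (simp only: cubic_cf_prodinf[OF q] m1_def m3_def m5_def)
    have "d > 0" by (simp add: d_def)
    have cd: "exp (- 3 * pi * t / 4) = c * d"
      unfolding c_def d_def exp_add[symmetric] by (rule arg_cong[of _ _ exp]) (simp add: field_simps)
    have "cubic_cf q * (2 * (c * D)) = d * (m1 * m5 * (p1 * p2)) / m3\<^sup>2 * (2 * c * r)"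
      by (simp add: V D_def mult_ac)
    also have "\<dots> = S * (1 / m3\<^sup>2 / p3\<^sup>2)"
      unfolding eul S_def cd using p3 by simp
    also have "1 / m3\<^sup>2 / p3\<^sup>2 = 1"
      using eul(1) by (simp add: divide_simps power_mult_distrib[symmetric] mult.commute)
    finally have "cubic_cf q * (2 * (c * D)) = S" by simp
    moreover have "cubic_cf q \<noteq> 0"
      using V m \<open>d > 0\<close> by simp
    ultimately show ?thesis
      by (simp add: field_simps)
  qed
  ultimately have "(f has_sum ((1 + 1 / cubic_cf q) * S)) UNIV"
    by (simp only:)
  from that[OF \<open>S > 0\<close> S this[unfolded f_def q_def]] show ?thesis .
qed

lemma cubic_cf_pos:
  assumes q: "0 < q" "q < 1"
  shows "cubic_cf q > 0"
  unfolding cubic_cf_prodinf[OF q] using q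
  by (intro mult_pos_pos divide_pos_pos zero_less_power prodinf_linear_power_pos) auto

text \<open>Poisson summation at \<open>t / 3\<close> and at \<open>3 * t\<close> carries the two
  half-integer series for \<open>t\<close> to the two alternating series for
  \<open>1 / (2 * t)\<close>. In the quotient the unknown theta values cancel, and what remains of
  the square roots is \<open>sqrt (3 * t) / sqrt (t / 3) = 3\<close>.\<close>

theorem cubic_cf_inversion:
  fixes t :: real
  assumes t: "t > 0"
  shows "(1 - 2 * cubic_cf (exp (- pi / t))) * (1 + cubic_cf (exp (- 2 * pi * t))) = 3 * cubic_cf (exp (- 2 * pi * t))"
proof -
  define V where "V = cubic_cf (exp (- 2 * pi * t))"
  define W where "W = cubic_cf (exp (- pi / t))"
  have "V > 0"
    using t by (simp add: V_def cubic_cf_pos)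
  obtain B where B: "B > 0" "((\<lambda>m::int. (-1) powi m * exp (- 6 * pi * (1 / (2 * t)) * (of_int m)\<^sup>2)) has_sum B) UNIV"
    "((\<lambda>m::int. (-1) powi m * exp (- 2 * pi * (1 / (2 * t)) * (of_int m)\<^sup>2 / 3)) has_sum
       (1 - 2 * cubic_cf (exp (- 2 * pi * (1 / (2 * t))))) * B) UNIV"
    using one_minus_2_cubic_cf[of "1 / (2 * t)"] t by auto
  obtain S where S: "S > 0" "((\<lambda>n::int. exp (- pi * (3 * t) * (of_int n + 1 / 2)\<^sup>2)) has_sum S) UNIV"
    "((\<lambda>n::int. exp (- pi * (t / 3) * (of_int n + 1 / 2)\<^sup>2)) has_sum (1 + 1 / V) * S) UNIV"
    using one_plus_inverse_cubic_cf[OF t] unfolding V_def by blast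
  have "t / 3 > 0" "3 * t > 0" using t by simp_all
  obtain X where X: "((\<lambda>n::int. exp (- pi * (t / 3) * (of_int n + 1 / 2)\<^sup>2)) has_sum X) UNIV"
    "((\<lambda>n::int. (-1) powi n * exp (- pi * (of_int n)\<^sup>2 / (t / 3))) has_sum (sqrt (t / 3) * X)) UNIV"
    using poisson_gauss[OF \<open>t / 3 > 0\<close>] by blast
  obtain Y where Y: "((\<lambda>n::int. exp (- pi * (3 * t) * (of_int n + 1 / 2)\<^sup>2)) has_sum Y) UNIV"
    "((\<lambda>n::int. (-1) powi n * exp (- pi * (of_int n)\<^sup>2 / (3 * t))) has_sum (sqrt (3 * t) * Y)) UNIV"
    using poisson_gauss[OF \<open>3 * t > 0\<close>] by blast
  have "X = (1 + 1 / V) * S" "Y = S"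
    using X(1) Y(1) S has_sum_unique by blast+
  have e: "- 6 * pi * (1 / (2 * t)) * (of_int m)\<^sup>2 = - pi * (of_int m)\<^sup>2 / (t / 3)"
      "- 2 * pi * (1 / (2 * t)) * (of_int m)\<^sup>2 / 3 = - pi * (of_int m)\<^sup>2 / (3 * t)"
      "- 2 * pi * (1 / (2 * t)) = - pi / t" for m :: int
    using t by (simp_all add: field_simps)
  have X_B: "sqrt (t / 3) * X = B"
    using B(2) X(2) unfolding e(1) by (rule has_sum_unique[rotated])
  have "sqrt (3 * t) = 3 * sqrt (t / 3)"
    using t by (intro real_sqrt_unique) (simp_all add: power_mult_distrib power2_eq_square)
  hence "sqrt (t / 3) * (3 * Y) = sqrt (3 * t) * Y"
    by (simp only: mult_ac)
  also have "\<dots> = (1 - 2 * W) * B"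
    using B(3) Y(2) unfolding e(2) unfolding e(3) W_def by (rule has_sum_unique[rotated])
  also have "\<dots> = sqrt (t / 3) * ((1 - 2 * W) * X)"
    unfolding X_B[symmetric] by (simp only: mult_ac)
  finally have "sqrt (t / 3) * (3 * Y) = sqrt (t / 3) * ((1 - 2 * W) * X)" .
  hence "3 * Y = (1 - 2 * W) * X"
    using t by simp
  hence "3 * S = (1 - 2 * W) * (1 + 1 / V) * S"
    unfolding \<open>X = _\<close> \<open>Y = S\<close> by (simp only: mult.assoc)
  hence "3 = (1 - 2 * W) * (1 + 1 / V)"
    using S(1) by simp
  hence "3 * V = (1 - 2 * W) * ((1 + 1 / V) * V)"
    by (metis mult.assoc)
  also have "(1 + 1 / V) * V = 1 + V"
    using \<open>V > 0\<close> by (simp add: field_simps)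
  finally show ?thesis
    unfolding V_def W_def by simp
qed

section \<open>The tetrahedral invariance of the modular polynomial\<close>

definition cubic7_poly :: "'a::comm_ring_1 \<Rightarrow> 'a \<Rightarrow> 'a" where
  "cubic7_poly u v = u^8 - u * v + 7 * u^4 * v + 28 * u^6 * v^2 - 56 * u^5 * v^3 + 7 * u * v^4
     + 21 * u^4 * v^4 - 56 * u^7 * v^4 - 56 * u^3 * v^5 + 28 * u^2 * v^6 - 56 * u^4 * v^7
     - 64 * u^7 * v^7 + v^8"

definition vertex_form :: "complex \<Rightarrow> complex" where
  "vertex_form u = u * (1 + u^3) * (1 - 8 * u^3)"

definition fricke_value :: "complex \<Rightarrow> complex" where
  "fricke_value u = (1 - 2 * u) / (2 + 2 * u)"

definition cubic7_ratio :: "complex \<Rightarrow> complex \<Rightarrow> complex" where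
  "cubic7_ratio u v = cubic7_poly u v / (vertex_form u * vertex_form v)"

lemma cubic7_poly_commute: "cubic7_poly u v = cubic7_poly v u"
  unfolding cubic7_poly_def by (simp add: algebra_simps)

lemma cubic7_ratio_commute: "cubic7_ratio u v = cubic7_ratio v u"
  by (simp add: cubic7_ratio_def cubic7_poly_commute[of u v] mult.commute)

lemma cubic7_ratio_rotate:
  assumes "w ^ 3 = 1"
  shows "cubic7_ratio (w * u) (w * v) = cubic7_ratio u v"
proof -
  have w: "w \<noteq> 0" using assms by auto
  have "cubic7_poly (w * u) (w * v) = w ^ 2 * cubic7_poly u v"
    using assms unfolding cubic7_poly_def by algebra
  moreover have "vertex_form (w * x) = w * vertex_form x" for x
    using assms unfolding vertex_form_def by algebra
  ultimately show ?thesis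
    using w by (simp add: cubic7_ratio_def power2_eq_square)
qed

text \<open>\<open>hom\<close> is the bihomogeneous form of bidegree \<open>(8, 8)\<close>. The
  constant is the eighth power of the determinant -6 of the Moebius map; each
  \<open>vertex_form\<close> contributes its fourth power, so the constants cancel in
  \<open>cubic7_ratio\<close>.\<close>

lemma cubic7_poly_fricke_value:
  assumes "u \<noteq> -1" "v \<noteq> -1"
  shows "cubic7_poly (fricke_value u) (fricke_value v) * ((2 + 2 * u) ^ 8 * (2 + 2 * v) ^ 8)
           = 6 ^ 8 * cubic7_poly u v"
proof -
  define b d where "b = 2 + 2 * u" and "d = 2 + 2 * v"
  have "b \<noteq> 0" "d \<noteq> 0"
    using assms by (simp_all add: b_def d_def add_eq_0_iff)
  hence num: "fricke_value u * b = 1 - 2 * u" "fricke_value v * d = 1 - 2 * v"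
    by (simp_all add: fricke_value_def b_def d_def)
  define hom where "hom = (\<lambda>a c.
     a^8 * d^8 - a * c * b^7 * d^7 + 7 * a^4 * c * b^4 * d^7 + 28 * a^6 * c^2 * b^2 * d^6
     - 56 * a^5 * c^3 * b^3 * d^5 + 7 * a * c^4 * b^7 * d^4 + 21 * a^4 * c^4 * b^4 * d^4
     - 56 * a^7 * c^4 * b * d^4 - 56 * a^3 * c^5 * b^5 * d^3 + 28 * a^2 * c^6 * b^6 * d^2
     - 56 * a^4 * c^7 * b^4 * d - 64 * a^7 * c^7 * b * d + c^8 * b^8)"
  have "cubic7_poly x y * (b ^ 8 * d ^ 8) = hom (x * b) (y * d)" for x y
    unfolding cubic7_poly_def hom_def by algebra
  from this[of "fricke_value u" "fricke_value v"]
  have "cubic7_poly (fricke_value u) (fricke_value v) * (b ^ 8 * d ^ 8) = hom (1 - 2 * u) (1 - 2 * v)"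
    by (simp only: num)
  also have "\<dots> = 6 ^ 8 * cubic7_poly u v"
    unfolding b_def d_def cubic7_poly_def hom_def by algebra
  finally show ?thesis
    by (simp only: b_def d_def)
qed

lemma vertex_form_fricke_value:
  assumes "u \<noteq> -1"
  shows "vertex_form (fricke_value u) * (2 + 2 * u) ^ 8 = 6 ^ 4 * vertex_form u"
proof -
  define b where "b = 2 + 2 * u"
  have "b \<noteq> 0"
    using assms by (simp add: b_def add_eq_0_iff)
  hence num: "fricke_value u * b = 1 - 2 * u"
    by (simp add: fricke_value_def b_def)
  \<comment> \<open>The factor \<open>b\<close> standing alone is the zero at infinity, which raises
    the degree from 7 to 8.\<close>
  have "vertex_form x * b ^ 8 = x * b * b * (b ^ 3 + (x * b) ^ 3) * (b ^ 3 - 8 * (x * b) ^ 3)" for x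
    unfolding vertex_form_def by algebra
  from this[of "fricke_value u"] show ?thesis
    unfolding num unfolding b_def vertex_form_def by algebra
qed

lemma cubic7_ratio_fricke_value:
  assumes "u \<noteq> -1" "v \<noteq> -1"
  shows "cubic7_ratio (fricke_value u) (fricke_value v) = cubic7_ratio u v"
proof -
  define b d where "b = 2 + 2 * u" and "d = 2 + 2 * v"
  have ne: "b \<noteq> 0" "d \<noteq> 0"
    using assms by (simp_all add: b_def d_def add_eq_0_iff)
  have "cubic7_ratio (fricke_value u) (fricke_value v)
      = cubic7_poly (fricke_value u) (fricke_value v) * (b ^ 8 * d ^ 8)
        / ((vertex_form (fricke_value u) * b ^ 8) * (vertex_form (fricke_value v) * d ^ 8))"
    using ne by (simp add: cubic7_ratio_def)
  also have "\<dots> = cubic7_ratio u v"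
    unfolding b_def d_def cubic7_poly_fricke_value[OF assms] vertex_form_fricke_value[OF assms(1)] vertex_form_fricke_value[OF assms(2)]
    by (simp add: cubic7_ratio_def)
  finally show ?thesis .
qed

section \<open>The maximum principle\<close>

definition fricke :: "complex \<Rightarrow> complex" where
  "fricke z = -1 / (2 * z)"

lemma Im_fricke: "Im (fricke z) = Im z / (2 * (norm z)\<^sup>2)"
proof -
  have "fricke z = - inverse z / 2"
    by (simp add: fricke_def field_simps)
  hence "Im (fricke z) = - Im (inverse z) / 2"
    by simp
  thus ?thesis
    by (simp add: cmod_power2)
qed

lemma Im_fricke_pos [simp]: "Im z > 0 \<Longrightarrow> Im (fricke z) > 0"
  by (auto simp: Im_fricke intro!: divide_pos_pos mult_pos_pos)

lemma linear_form_nonzero: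
  assumes "Im z > 0" "a \<noteq> 0 \<or> b \<noteq> 0"
  shows "of_real a * z + of_real b \<noteq> 0"
  using assms by (auto simp: complex_eq_iff)

text \<open>The properties of \<open>V\<close> from which the modular equation follows. The last
  assumption normalizes \<open>f\<close> at the cusp and is where the special role of the terms
  \<open>u^8 - u * v\<close> enters.\<close>

locale cubic_modular =
  fixes f :: "complex \<Rightarrow> complex" and w :: complex
  assumes hol: "f holomorphic_on {z. Im z > 0}"
    and nonzero: "Im z > 0 \<Longrightarrow> f z \<noteq> 0"
    and w: "w ^ 3 = 1" "w \<noteq> 1"
    and shift: "Im z > 0 \<Longrightarrow> f (z + 1) = w * f z"
    and inversion: "Im z > 0 \<Longrightarrow> (1 - 2 * f (fricke z)) * (1 + f z) = 3 * f z"
    and cusp_zero: "(f \<longlongrightarrow> 0) (filtercomap Im at_top)"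
    and cusp_ratio: "((\<lambda>z. f z ^ 7 / f (7 * z)) \<longlongrightarrow> 1) (filtercomap Im at_top)"
begin

lemma f_ne_minus1: "Im z > 0 \<Longrightarrow> f z \<noteq> -1"
  using inversion[of z] by auto

lemma f_fricke:
  assumes "Im z > 0" shows "f (fricke z) = fricke_value (f z)"
proof -
  have "1 + f z \<noteq> 0"
    using f_ne_minus1[OF assms] by (simp add: add_eq_0_iff)
  hence "2 + 2 * f z \<noteq> 0"
    by (metis distrib_left mult_1_right mult_eq_0_iff zero_neq_numeral)
  moreover have "f (fricke z) * (2 + 2 * f z) = 1 - 2 * f z"
    using inversion[OF assms] by (simp add: algebra_simps)
  ultimately show ?thesis
    by (simp add: fricke_value_def eq_divide_eq)
qed

text \<open>The value -1 is excluded because the inversion formula would read \<open>0 = -3\<close>,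
  and \<open>1 / 2\<close> because \<open>f (fricke z)\<close> is nonzero. Translating by 1 and 2
  rotates these exclusions to the remaining roots of \<open>1 + u^3\<close> and
  \<open>1 - 8 * u^3\<close>.\<close>

lemma vertex_form_nonzero:
  assumes "Im z > 0" shows "vertex_form (f z) \<noteq> 0"
proof -
  have w': "1 + w + w ^ 2 = 0"
  proof -
    have "(w - 1) * (1 + w + w ^ 2) = w ^ 3 - 1"
      by (simp add: algebra_simps power2_eq_square power3_eq_cube)
    thus ?thesis using w by simp
  qed
  have prod: "(1 + x) * (1 + w * x) * (1 + w ^ 2 * x) = 1 + x ^ 3" for x
  proof -
    have "(1 + x) * (1 + w * x) * (1 + w ^ 2 * x)
        = 1 + x * (1 + w + w ^ 2) + x ^ 2 * w * (1 + w + w ^ 2) + w ^ 3 * x ^ 3"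
      by (simp add: algebra_simps power2_eq_square power3_eq_cube)
    thus ?thesis using w w' by simp
  qed
  have m: "w * (w * f z) = w ^ 2 * f z"
    by (simp add: power2_eq_square)
  have "f z \<noteq> -1" "w * f z \<noteq> -1" "w ^ 2 * f z \<noteq> -1"
    using f_ne_minus1[of z] f_ne_minus1[of "z + 1"] f_ne_minus1[of "z + 1 + 1"] assms
      shift[of z] shift[of "z + 1"]
    by (simp_all only: m plus_complex.sel one_complex.sel add_0_right simp_thms)
  hence "(1 + f z) * (1 + w * f z) * (1 + w ^ 2 * f z) \<noteq> 0"
    by (auto simp: add_eq_0_iff)
  also have "(1 + f z) * (1 + w * f z) * (1 + w ^ 2 * f z) = 1 + f z ^ 3"
    by (rule prod)
  finally have 1: "1 + f z ^ 3 \<noteq> 0" .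
  have *: "2 * f z \<noteq> 1" if "Im z > 0" for z
    using nonzero[of "fricke z"] that by (auto simp: f_fricke fricke_value_def)
  have "2 * f z \<noteq> 1" "2 * (w * f z) \<noteq> 1" "2 * (w ^ 2 * f z) \<noteq> 1"
    using *[of z] *[of "z + 1"] *[of "z + 1 + 1"] assms shift[of z] shift[of "z + 1"]
    by (simp_all only: m plus_complex.sel one_complex.sel add_0_right simp_thms)
  hence "(1 - 2 * f z) * (1 - 2 * (w * f z)) * (1 - 2 * (w ^ 2 * f z)) \<noteq> 0"
    by auto
  also have "(1 - 2 * f z) * (1 - 2 * (w * f z)) * (1 - 2 * (w ^ 2 * f z)) = 1 - 8 * f z ^ 3"
    using prod[of "- 2 * f z"] by (simp add: mult.left_commute power_mult_distrib)
  finally show ?thesis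
    using 1 nonzero[OF assms] by (simp add: vertex_form_def)
qed

section \<open>Substitutions that leave the values of f unchanged\<close>

lemma shift_back: "Im z > 0 \<Longrightarrow> f (z - 1) = w ^ 2 * f z"
  using shift[of "z - 1"] w by (simp add: power2_eq_square power3_eq_cube mult.assoc[symmetric])

lemma shift3: "Im z > 0 \<Longrightarrow> f (z + 3) = f z"
proof -
  assume z: "Im z > 0"
  have "f (z + 1 + 1 + 1) = w ^ 3 * f z"
    using z by (subst shift, simp)+ (simp add: power3_eq_cube mult.assoc)
  thus ?thesis using w by (simp add: add.assoc)
qed

lemma shift3_int:
  assumes "Im z > 0" shows "f (z + 3 * of_int n) = f z"
proof -
  have nat: "f (z + 3 * of_nat m) = f z" if "Im z > 0" for m z
    using that
  proof (induction m)
    case (Suc m)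
    have "f (z + 3 * of_nat (Suc m)) = f ((z + 3 * of_nat m) + 3)"
      by (simp add: algebra_simps)
    also have "\<dots> = f (z + 3 * of_nat m)"
      using Suc.prems by (intro shift3) auto
    finally show ?case using Suc by simp
  qed auto
  show ?thesis
  proof (cases n)
    case (nonneg m)
    thus ?thesis using nat[OF assms, of m] by simp
  next
    case (neg m)
    thus ?thesis using nat[of "z + 3 * of_int n" "Suc m"] assms by simp
  qed
qed

text \<open>Stands in for equivalence under the group fixing \<open>f\<close>. It is compatible with
  translation and inversion because \<open>f\<close> at the image point is a function of
  \<open>f\<close> at the point, so words in the generators can be handled without matrices.\<close>

definition same :: "complex \<Rightarrow> complex \<Rightarrow> bool" where
  "same x y \<longleftrightarrow> Im x > 0 \<and> Im y > 0 \<and> f x = f y"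

lemma same_refl: "Im x > 0 \<Longrightarrow> same x x"
  by (simp add: same_def)

lemma same_trans: "same x y \<Longrightarrow> same y z \<Longrightarrow> same x z"
  by (simp add: same_def)

lemma same_shift: "same x y \<Longrightarrow> same (x + 1) (y + 1)"
  by (auto simp: same_def shift)

lemma same_shift_back: "same x y \<Longrightarrow> same (x - 1) (y - 1)"
  by (auto simp: same_def shift_back)

lemma same_fricke: "same x y \<Longrightarrow> same (fricke x) (fricke y)"
  by (auto simp: same_def f_fricke)

lemma same_shift3: "same x y \<Longrightarrow> same (x + 3) y" "same x y \<Longrightarrow> same (x - 3) y"
  using shift3_int[of x "-1"] by (auto simp: same_def shift3)

lemma fricke_fricke: "z \<noteq> 0 \<Longrightarrow> fricke (fricke z) = z"
  by (simp add: fricke_def)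

text \<open>Translation by 1 conjugated by the inversion: the parabolic map
  \<open>z / (1 - 2 * z)\<close>, see \<open>fricke3_eq\<close>. Conjugating the period-3
  translation by it gives the maps of \<open>same_word12\<close>.\<close>

definition conj_shift :: "complex \<Rightarrow> complex" where "conj_shift z = fricke (fricke z + 1)"
definition conj_unshift :: "complex \<Rightarrow> complex" where "conj_unshift z = fricke (fricke z - 1)"

lemma conj_shift_unshift: assumes "Im z > 0" shows "conj_shift (conj_unshift z) = z" "conj_unshift (conj_shift z) = z"
proof -
  have "fricke z - 1 \<noteq> 0" "fricke z + 1 \<noteq> 0" "z \<noteq> 0"
    using linear_form_nonzero[of "fricke z" 1 "-1"] linear_form_nonzero[of "fricke z" 1 "1"] assms by auto
  thus "conj_shift (conj_unshift z) = z" "conj_unshift (conj_shift z) = z"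
    by (auto simp: conj_shift_def conj_unshift_def fricke_fricke)
qed

lemma same_conj_shift: "same x y \<Longrightarrow> same (conj_shift x) (conj_shift y)" "same x y \<Longrightarrow> same (conj_unshift x) (conj_unshift y)"
  unfolding conj_shift_def conj_unshift_def by (intro same_fricke same_shift same_shift_back; assumption)+

lemma Im_conj_shift: "Im z > 0 \<Longrightarrow> Im (conj_shift z) > 0" "Im z > 0 \<Longrightarrow> Im (conj_unshift z) > 0"
  unfolding conj_shift_def conj_unshift_def by (intro Im_fricke_pos; simp)+

lemma same_fricke3:
  assumes "Im z > 0" shows "same (fricke (fricke z + 3)) z" "same (fricke (fricke z - 3)) z"
proof -
  have "same (fricke (fricke z + 3)) (fricke (fricke z))" "same (fricke (fricke z - 3)) (fricke (fricke z))"
    using assms by (auto intro!: same_fricke same_shift3 same_refl)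
  moreover have "z \<noteq> 0" using assms by auto
  ultimately show "same (fricke (fricke z + 3)) z" "same (fricke (fricke z - 3)) z"
    by (simp_all add: fricke_fricke)
qed

lemma same_conj_shift3:
  assumes "Im z > 0"
  shows "same (conj_shift (conj_unshift z + 3)) z" "same (conj_shift (conj_unshift z - 3)) z"
        "same (conj_unshift (conj_shift z + 3)) z" "same (conj_unshift (conj_shift z - 3)) z"
proof -
  have "same (conj_shift (conj_unshift z + 3)) (conj_shift (conj_unshift z))" "same (conj_shift (conj_unshift z - 3)) (conj_shift (conj_unshift z))"
        "same (conj_unshift (conj_shift z + 3)) (conj_unshift (conj_shift z))" "same (conj_unshift (conj_shift z - 3)) (conj_unshift (conj_shift z))"
    using assms by (auto intro!: same_conj_shift same_shift3 same_refl Im_conj_shift)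
  thus "same (conj_shift (conj_unshift z + 3)) z" "same (conj_shift (conj_unshift z - 3)) z"
        "same (conj_unshift (conj_shift z + 3)) z" "same (conj_unshift (conj_shift z - 3)) z"
    using assms by (simp_all add: conj_shift_unshift)
qed

lemma fricke3_eq:
  assumes "Im z > 0"
  shows "fricke (fricke z - 3) = z / (6 * z + 1)" "fricke (fricke z + 3) = z / (1 - 6 * z)"
        "conj_shift z = z / (1 - 2 * z)" "conj_unshift z = z / (1 + 2 * z)"
proof -
  have ne: "z \<noteq> 0"
    using assms by auto
  have "fricke (- (r / (2 * z))) = z / r" for r
    using ne by (simp add: fricke_def)
  moreover have "fricke z - 3 = - ((6 * z + 1) / (2 * z))" "fricke z + 3 = - ((1 - 6 * z) / (2 * z))"
       "fricke z + 1 = - ((1 - 2 * z) / (2 * z))" "fricke z - 1 = - ((1 + 2 * z) / (2 * z))"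
    using ne by (simp_all add: fricke_def diff_divide_distrib add_divide_distrib)
  ultimately show "fricke (fricke z - 3) = z / (6 * z + 1)" "fricke (fricke z + 3) = z / (1 - 6 * z)"
        "conj_shift z = z / (1 - 2 * z)" "conj_unshift z = z / (1 + 2 * z)"
    unfolding conj_shift_def conj_unshift_def by simp_all
qed

lemma conj_shift_frac:
  assumes "Im (a / b) > 0"
  shows "conj_shift (a / b) = a / (b - 2 * a)" "conj_unshift (a / b) = a / (b + 2 * a)"
proof -
  have b: "b \<noteq> 0"
    using assms by auto
  have "1 - 2 * (a / b) = (b - 2 * a) / b" "1 + 2 * (a / b) = (b + 2 * a) / b"
    using b by (simp_all add: diff_divide_distrib add_divide_distrib)
  thus "conj_shift (a / b) = a / (b - 2 * a)" "conj_unshift (a / b) = a / (b + 2 * a)"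
    using assms b by (simp_all only: fricke3_eq) simp_all
qed

text \<open>Parabolic maps: \<open>z / (1 - 6 * z)\<close> and its inverse, conjugated by a
  translation by 1 or -1. The first two have numerators of the shape \<open>7 * z - 3 * k\<close>
  required by \<open>f_fricke_seventh\<close>; the last two are their inverses, used for
  \<open>same_word18\<close>.\<close>

lemma same_word6:
  assumes "Im z > 0"
  shows "same ((7 * z + 6) / (-6 * z - 5)) z" "same ((7 * z - 6) / (6 * z - 5)) z"
        "same ((-5 * z - 6) / (6 * z + 7)) z" "same ((-5 * z + 6) / (-6 * z + 7)) z"
proof -
  have ne: "-6 * z - 5 \<noteq> 0" "6 * z - 5 \<noteq> 0" "6 * z + 7 \<noteq> 0" "-6 * z + 7 \<noteq> 0"
    using assms by (auto simp: complex_eq_iff)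
  note down = same_shift_back[of _ "z + 1"]
  note up = same_shift[of _ "z - 1"]
  have "fricke (fricke (z + 1) + 3) - 1 = (z + 1) / (-6 * z - 5) - 1"
    using assms by (simp add: fricke3_eq)
  also have "\<dots> = (7 * z + 6) / (-6 * z - 5)"
    using ne(1) by (simp add: divide_diff_eq_iff)
  finally show "same ((7 * z + 6) / (-6 * z - 5)) z"
    using down[OF same_fricke3(1)[of "z + 1"]] assms by simp

  have "fricke (fricke (z - 1) - 3) + 1 = (z - 1) / (6 * z - 5) + 1"
    using assms by (simp add: fricke3_eq)
  also have "\<dots> = (7 * z - 6) / (6 * z - 5)"
    using ne(2) by (simp add: divide_add_eq_iff)
  finally show "same ((7 * z - 6) / (6 * z - 5)) z"
    using up[OF same_fricke3(2)[of "z - 1"]] assms by simp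

  have "fricke (fricke (z + 1) - 3) - 1 = (z + 1) / (6 * z + 7) - 1"
    using assms by (simp add: fricke3_eq)
  also have "\<dots> = (-5 * z - 6) / (6 * z + 7)"
    using ne(3) by (simp add: divide_diff_eq_iff)
  finally show "same ((-5 * z - 6) / (6 * z + 7)) z"
    using down[OF same_fricke3(2)[of "z + 1"]] assms by simp

  have "fricke (fricke (z - 1) + 3) + 1 = (z - 1) / (-6 * z + 7) + 1"
    using assms by (simp add: fricke3_eq)
  also have "\<dots> = (-5 * z + 6) / (-6 * z + 7)"
    using ne(4) by (simp add: divide_add_eq_iff)
  finally show "same ((-5 * z + 6) / (-6 * z + 7)) z"
    using up[OF same_fricke3(1)[of "z - 1"]] assms by simp
qed

lemma same_word12:
  assumes "Im z > 0"
  shows "same ((7 * z + 3) / (-12 * z - 5)) z" "same ((7 * z - 3) / (12 * z - 5)) z"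
        "same ((-5 * z - 3) / (12 * z + 7)) z" "same ((-5 * z + 3) / (-12 * z + 7)) z"
proof -
  have ne: "1 + 2 * z \<noteq> 0" "1 - 2 * z \<noteq> 0" "2 * z \<noteq> 1"
    using assms by (auto simp: complex_eq_iff)
  have eq: "conj_unshift z + 3 = (7 * z + 3) / (1 + 2 * z)" "conj_shift z - 3 = (7 * z - 3) / (1 - 2 * z)"
       "conj_unshift z - 3 = (-5 * z - 3) / (1 + 2 * z)" "conj_shift z + 3 = (-5 * z + 3) / (1 - 2 * z)"
    using assms ne by (simp_all add: fricke3_eq divide_diff_eq_iff divide_add_eq_iff)
  have im: "Im (conj_unshift z + 3) > 0" "Im (conj_shift z - 3) > 0" "Im (conj_unshift z - 3) > 0" "Im (conj_shift z + 3) > 0"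
    using Im_conj_shift[OF assms] by simp_all
  have "conj_shift (conj_unshift z + 3) = (7 * z + 3) / (-12 * z - 5)" "conj_unshift (conj_shift z - 3) = (7 * z - 3) / (12 * z - 5)"
       "conj_shift (conj_unshift z - 3) = (-5 * z - 3) / (12 * z + 7)" "conj_unshift (conj_shift z + 3) = (-5 * z + 3) / (-12 * z + 7)"
    using im unfolding eq by (simp_all add: conj_shift_frac)
  thus "same ((7 * z + 3) / (-12 * z - 5)) z" "same ((7 * z - 3) / (12 * z - 5)) z"
        "same ((-5 * z - 3) / (12 * z + 7)) z" "same ((-5 * z + 3) / (-12 * z + 7)) z"
    using same_conj_shift3[OF assms] by simp_all
qed

text \<open>These maps have trace -16, hence are not conjugates of a translation; each is an inverse
  from \<open>same_word6\<close> followed by one from \<open>same_word12\<close>.\<close>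

lemma same_word18:
  assumes "Im z > 0"
  shows "same ((7 * z + 9) / (-18 * z - 23)) z" "same ((7 * z - 9) / (18 * z - 23)) z"
proof -
  have ne: "6 * z + 7 \<noteq> 0" "-6 * z + 7 \<noteq> 0"
    using assms by (auto simp: complex_eq_iff)
  define y where "y = (-5 * z - 6) / (6 * z + 7)"
  have y: "same y z"
    using same_word6(3)[OF assms] by (simp add: y_def)
  hence "same ((-5 * y - 3) / (12 * y + 7)) z"
    using same_word12(3)[of y] same_trans same_def by blast
  moreover have "-5 * y - 3 = (7 * z + 9) / (6 * z + 7)" "12 * y + 7 = (-18 * z - 23) / (6 * z + 7)"
    unfolding y_def using ne by (simp_all add: divide_add_eq_iff divide_diff_eq_iff)
  ultimately show "same ((7 * z + 9) / (-18 * z - 23)) z"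
    using ne by simp
  define y' where "y' = (-5 * z + 6) / (-6 * z + 7)"
  have y: "same y' z"
    using same_word6(4)[OF assms] by (simp add: y'_def)
  hence "same ((-5 * y' + 3) / (-12 * y' + 7)) z"
    using same_word12(4)[of y'] same_trans same_def by blast
  moreover have "-5 * y' + 3 = (7 * z - 9) / (-6 * z + 7)" "-12 * y' + 7 = (18 * z - 23) / (-6 * z + 7)"
    unfolding y'_def using ne by (simp_all add: divide_add_eq_iff divide_diff_eq_iff)
  ultimately show "same ((7 * z - 9) / (18 * z - 23)) z"
    using ne by simp
qed

end

section \<open>The action of the generators on the eight values\<close>

context cubic_modular
begin

text \<open>With \<open>p = 7 * z - 3 * k\<close>, the point \<open>(fricke p + 3 * j) / 7\<close>
  is \<open>fricke (p / r)\<close>. So the claim reduces to \<open>f\<close> taking the same value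
  at \<open>p / r\<close> and at \<open>z\<close>, where \<open>p / r\<close> is a substitution of
  determinant 1 applied to \<open>z\<close>.\<close>

lemma f_fricke_seventh:
  assumes "Im z > 0" and "same ((7 * z - 3 * of_int k) / r) z"
    and "7 * r = 1 - 6 * of_int j * (7 * z - 3 * of_int k)"
  shows "f ((fricke (7 * z - 3 * of_int k) + 3 * of_int j) / 7) = fricke_value (f z)"
proof -
  define p where "p = 7 * z - 3 * of_int k"
  have p: "p \<noteq> 0"
    using assms(1) by (auto simp: p_def complex_eq_iff)
  have "(fricke p + 3 * of_int j) / 7 = - (7 * r) / (2 * p) / 7"
    unfolding assms(3) p_def[symmetric] using p by (simp add: fricke_def divide_add_eq_iff) (simp add: field_simps)
  also have "\<dots> = fricke (p / r)"
    by (simp add: fricke_def)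
  finally show ?thesis
    using assms(2) f_fricke[of "p / r"] unfolding p_def same_def by simp
qed

text \<open>Integrality of \<open>r\<close> forces \<open>j * k\<close> to be 5 modulo 7.\<close>

lemma f_fricke_seventh_ex:
  assumes "Im t > 0" and "j \<in> {-3..3}" "j \<noteq> 0"
  shows "\<exists>k. f ((fricke t + 3 * of_int j) / 7) = fricke_value (f ((t + 3 * of_int k) / 7))"
proof -
  have *: "\<exists>k. f ((fricke t + 3 * of_int j) / 7) = fricke_value (f ((t + 3 * of_int k) / 7))"
    if *: "\<And>z. Im z > 0 \<Longrightarrow> same ((7 * z - 3 * of_int k) / r z) z"
        "\<And>z. 7 * r z = 1 - 6 * of_int j * (7 * z - 3 * of_int k)" for r k
  proof -
    define z where "z = (t + 3 * of_int k) / 7"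
    have t: "t = 7 * z - 3 * of_int k" and z: "Im z > 0"
      using assms by (simp_all add: z_def field_simps)
    from f_fricke_seventh[OF z *(1)[OF z] *(2)] show ?thesis
      unfolding t[symmetric] by (intro exI[of _ k]) (simp add: z_def)
  qed
  \<comment> \<open>In each case \<open>j * k\<close> is -2 or -9, and \<open>r\<close> is
    \<open>(1 + 18 * j * k) / 7 - 6 * j * z\<close> with constant term -5 or -23.\<close>
  from assms consider "j = 1" | "j = 2" | "j = 3" | "j = -1" | "j = -2" | "j = -3"
    by fastforce
  thus ?thesis
  proof cases
    case 1 show ?thesis
      by (rule *[of "-2" "\<lambda>z. -6 * z - 5"]) (use same_word6(1) 1 in \<open>simp_all add: algebra_simps\<close>)
  next
    case 2 show ?thesis
      by (rule *[of "-1" "\<lambda>z. -12 * z - 5"]) (use same_word12(1) 2 in \<open>simp_all add: algebra_simps\<close>)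
  next
    case 3 show ?thesis
      by (rule *[of "-3" "\<lambda>z. -18 * z - 23"]) (use same_word18(1) 3 in \<open>simp_all add: algebra_simps\<close>)
  next
    case 4 show ?thesis
      by (rule *[of 2 "\<lambda>z. 6 * z - 5"]) (use same_word6(2) 4 in \<open>simp_all add: algebra_simps\<close>)
  next
    case 5 show ?thesis
      by (rule *[of 1 "\<lambda>z. 12 * z - 5"]) (use same_word12(2) 5 in \<open>simp_all add: algebra_simps\<close>)
  next
    case 6 show ?thesis
      by (rule *[of 3 "\<lambda>z. 18 * z - 23"]) (use same_word18(2) 6 in \<open>simp_all add: algebra_simps\<close>)
  qed
qed

definition F :: "complex \<Rightarrow> complex" where
  "F z = cubic7_ratio (f z) (f (7 * z))"

text \<open>Since 7 is 1 modulo 3, translation by 1 rotates both arguments by the same cube root of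
  unity, which is the diagonal action under which the ratio is invariant.\<close>

lemma F_shift: assumes "Im z > 0" shows "F (z + 1) = F z"
proof -
  have "f (7 * (z + 1)) = f ((7 * z + 1) + 3 * of_int 2)"
    by (simp add: algebra_simps)
  also have "\<dots> = w * f (7 * z)"
    using assms by (subst shift3_int) (simp_all add: shift)
  finally show ?thesis
    using w assms by (simp add: F_def shift cubic7_ratio_rotate)
qed

lemma F_shift_int:
  assumes "Im z > 0" shows "F (z + of_int n) = F z"
proof -
  have nat: "F (z + of_nat m) = F z" if "Im z > 0" for m z
    using that
  proof (induction m)
    case (Suc m)
    have "F (z + of_nat (Suc m)) = F ((z + of_nat m) + 1)"
      by (simp add: algebra_simps)
    also have "\<dots> = F (z + of_nat m)"
      using Suc.prems by (intro F_shift) auto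
    finally show ?case using Suc by simp
  qed auto
  show ?thesis
  proof (cases n)
    case (nonneg m)
    thus ?thesis using nat[OF assms, of m] by simp
  next
    case (neg m)
    thus ?thesis using nat[of "z + of_int n" "Suc m"] assms by simp
  qed
qed

text \<open>The period 3 of \<open>f\<close> makes one argument equal to \<open>f t\<close> for
  every \<open>j\<close>; the symmetry of the polynomial puts it first.\<close>

lemma F_seventh:
  assumes "Im t > 0"
  shows "F ((t + 3 * of_int j) / 7) = cubic7_ratio (f t) (f ((t + 3 * of_int j) / 7))"
proof -
  have "7 * ((t + 3 * of_int j) / 7) = t + 3 * of_int j"
    by (simp add: field_simps)
  hence "F ((t + 3 * of_int j) / 7) = cubic7_ratio (f ((t + 3 * of_int j) / 7)) (f t)"
    using assms unfolding F_def by (simp only: shift3_int)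
  thus ?thesis
    by (simp only: cubic7_ratio_commute)
qed

lemma F_fricke: assumes "Im t > 0" shows "F (fricke t) = F (t / 7)"
proof -
  have "7 * fricke t = fricke (t / 7)"
    by (simp add: fricke_def)
  thus ?thesis
    using assms f_ne_minus1 by (simp add: F_def f_fricke cubic7_ratio_fricke_value cubic7_ratio_commute)
qed

text \<open>There are at most eight values, since \<open>F\<close> has period 1.\<close>

definition orbit :: "complex \<Rightarrow> complex set" where
  "orbit t = insert (F t) (range (\<lambda>j::int. F ((t + 3 * of_int j) / 7)))"

lemma orbit_seventh: "F ((t + 3 * of_int j) / 7) \<in> orbit t"
  by (auto simp: orbit_def)

lemma orbit_shift:
  assumes "Im t > 0" shows "orbit t \<subseteq> orbit (t + of_int n)"
proof
  fix x assume "x \<in> orbit t"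
  then consider "x = F t" | j where "x = F ((t + 3 * of_int j) / 7)"
    by (auto simp: orbit_def)
  thus "x \<in> orbit (t + of_int n)"
  proof cases
    case 1 thus ?thesis using assms by (simp add: orbit_def F_shift_int)
  next
    case (2 j)
    \<comment> \<open>The index moves by \<open>2 * n\<close> because
      \<open>n + 3 * (2 * n) = 7 * n\<close>, a translation by \<open>n\<close> after division by
      7.\<close>
    have eq: "(t + of_int n + 3 * of_int (j + 2 * n)) / 7 = (t + 3 * of_int j) / 7 + of_int n"
      by (simp add: field_simps)
    have "F ((t + of_int n + 3 * of_int (j + 2 * n)) / 7) = x"
      unfolding eq 2 using assms by (intro F_shift_int) simp
    thus ?thesis
      using orbit_seventh by metis
  qed
qed

text \<open>The inversion exchanges the value at the point itself with the value for
  \<open>j = 0\<close>, by \<open>F_fricke\<close>, and permutes the remaining ones, by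
  \<open>f_fricke_seventh_ex\<close>.\<close>

lemma orbit_fricke:
  assumes "Im t > 0" shows "orbit t \<subseteq> orbit (fricke t)"
proof
  fix x assume "x \<in> orbit t"
  have ff: "fricke (fricke t) = t"
    using assms by (intro fricke_fricke) auto
  have im: "Im (fricke t) > 0"
    using assms by simp
  from \<open>x \<in> orbit t\<close> consider "x = F t" | j where "x = F ((t + 3 * of_int j) / 7)"
    by (auto simp: orbit_def)
  thus "x \<in> orbit (fricke t)"
  proof cases
    case 1
    hence "x = F (fricke t / 7)"
      using F_fricke[OF im] by (simp add: ff)
    thus ?thesis using orbit_seventh[of "fricke t" 0] by simp
  next
    case (2 j)
    \<comment> \<open>The representative of \<open>j\<close> modulo 7 in \<open>{-3..3}\<close>, for
      which explicit words are available; \<open>F\<close> is unchanged since \<open>j\<close> and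
      \<open>i\<close> give points differing by the integer \<open>3 * m\<close>.\<close>
    define i where "i = (j + 3) mod 7 - 3"
    define m where "m = (j + 3) div 7"
    have j: "j = i + 7 * m"
      unfolding i_def m_def by presburger
    have i: "i \<in> {-3..3}"
      unfolding i_def by auto
    have eq: "(t + 3 * of_int j) / 7 = (t + 3 * of_int i) / 7 + of_int (3 * m)"
      by (simp add: j field_simps)
    have x: "x = F ((t + 3 * of_int i) / 7)"
      unfolding 2 eq using assms by (intro F_shift_int) simp
    show ?thesis
    proof (cases "i = 0")
      case True
      have tt: "t / 7 = fricke (7 * fricke t)"
        using ff by (simp add: fricke_def)
      have "x = F (t / 7)"
        using x True by simp
      also have "\<dots> = F (fricke t)"
        unfolding tt using F_fricke[of "7 * fricke t"] im by simp
      finally have "x = F (fricke t)" .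
      thus ?thesis by (simp add: orbit_def)
    next
      case False
      obtain k where k: "f ((fricke (fricke t) + 3 * of_int i) / 7) = fricke_value (f ((fricke t + 3 * of_int k) / 7))"
        using f_fricke_seventh_ex[OF im i False] by blast
      have "x = cubic7_ratio (f (fricke (fricke t))) (f ((fricke (fricke t) + 3 * of_int i) / 7))"
        using x F_seventh[OF assms] by (simp add: ff)
      also have "\<dots> = cubic7_ratio (f (fricke t)) (f ((fricke t + 3 * of_int k) / 7))"
        unfolding k f_fricke[OF im] using im by (intro cubic7_ratio_fricke_value f_ne_minus1) auto
      also have "\<dots> = F ((fricke t + 3 * of_int k) / 7)"
        using F_seventh[OF im] by simp
      finally show ?thesis using orbit_seventh by metis
    qed
  qed
qed

section \<open>Reduction to points of bounded height\<close>

lemma shift_to_strip: "\<exists>n::int. \<bar>Re (z + of_int n)\<bar> \<le> 1 / 2"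
  by (rule exI[of _ "- round (Re z)"]) (use of_int_round_abs_le[of "Re z"] in \<open>simp add: abs_minus_commute\<close>)

text \<open>Below height \<open>9 / 20\<close> in the strip, \<open>2 * (norm t)^2\<close> is at
  most \<open>2 * (1 / 4 + 81 / 400) < 10 / 11\<close>, so inversion raises the height by a factor
  of at least \<open>11 / 10\<close> and finitely many rounds suffice. The fundamental domain
  reaches down to height \<open>1 / 2\<close>; the smaller bound provides the uniform
  factor.\<close>

lemma orbit_reduce:
  assumes "Im t > 0"
  shows "\<exists>s. Im s \<ge> 9 / 20 \<and> orbit t \<subseteq> orbit s"
proof -
  have "\<exists>s. Im s \<ge> 9 / 20 \<and> orbit t \<subseteq> orbit s"
    if "Im t > 0" "Im t * (11 / 10) ^ n \<ge> 9 / 20" for n t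
    using that
  proof (induction n arbitrary: t)
    case (Suc n)
    obtain m :: int where m: "\<bar>Re (t + of_int m)\<bar> \<le> 1 / 2"
      using shift_to_strip by blast
    define t' where "t' = t + of_int m"
    have t': "Im t' = Im t" "\<bar>Re t'\<bar> \<le> 1 / 2" "orbit t \<subseteq> orbit t'"
      using m orbit_shift[OF Suc.prems(1)] by (simp_all add: t'_def)
    show ?case
    proof (cases "Im t \<ge> 9 / 20")
      case False
      have "(Re t')\<^sup>2 \<le> (1 / 2)\<^sup>2" "(Im t')\<^sup>2 \<le> (9 / 20)\<^sup>2"
        using t' False Suc.prems(1) by (auto simp: abs_le_square_iff[symmetric])
      hence n: "2 * (norm t')\<^sup>2 \<le> 10 / 11"
        unfolding cmod_power2 by (simp add: power2_eq_square)
      have pos: "2 * (norm t')\<^sup>2 > 0"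
        using Suc.prems(1) t'(1) by auto
      have "Im t * (11 / 10) \<le> Im t' / (2 * (norm t')\<^sup>2)"
        unfolding t'(1) using pos n Suc.prems(1)
        by (simp add: pos_le_divide_eq mult.assoc)
      hence "Im t * (11 / 10) * (11 / 10) ^ n \<le> Im (fricke t') * (11 / 10) ^ n"
        by (intro mult_right_mono) (auto simp: Im_fricke)
      hence "Im (fricke t') * (11 / 10) ^ n \<ge> 9 / 20"
        using Suc.prems(2) unfolding power_Suc mult.assoc by linarith
      moreover have "Im (fricke t') > 0"
        using Suc.prems(1) t'(1) by simp
      ultimately obtain s where "Im s \<ge> 9 / 20" "orbit (fricke t') \<subseteq> orbit s"
        using Suc.IH by blast
      moreover have "orbit t' \<subseteq> orbit (fricke t')"
        using Suc.prems(1) t'(1) by (intro orbit_fricke) simp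
      ultimately show ?thesis using t'(3) by blast
    qed auto
  qed auto
  moreover obtain n where "(9 / 20) / Im t < (11 / 10) ^ n"
    using real_arch_pow[of "11 / 10"] by auto
  ultimately show ?thesis
    using assms by (metis less_imp_le mult.commute pos_divide_less_eq)
qed

text \<open>\<open>9 / 140\<close> is a seventh of \<open>9 / 20\<close>: the value may be attained
  at one of the points \<open>(s + 3 * j) / 7\<close> instead of at \<open>s\<close>.\<close>

lemma F_reduce:
  assumes "Im t > 0"
  shows "\<exists>s. Im s \<ge> 9 / 140 \<and> \<bar>Re s\<bar> \<le> 1 / 2 \<and> F t = F s"
proof -
  obtain s where s: "Im s \<ge> 9 / 20" "orbit t \<subseteq> orbit s"
    using orbit_reduce[OF assms] by blast
  hence "F t \<in> orbit s" by (auto simp: orbit_def)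
  then consider "F t = F s" | j :: int where "F t = F ((s + 3 * of_int j) / 7)"
    by (auto simp: orbit_def)
  then obtain r where r: "Im r \<ge> 9 / 140" "F t = F r"
  proof cases
    case 1 thus ?thesis using that[of s] s(1) by simp
  next
    case (2 j) thus ?thesis using that[of "(s + 3 * of_int j) / 7"] s(1) by simp
  qed
  obtain m :: int where m: "\<bar>Re (r + of_int m)\<bar> \<le> 1 / 2"
    using shift_to_strip by blast
  have "F (r + of_int m) = F r"
    using r by (intro F_shift_int) auto
  with r m show ?thesis
    by (intro exI[of _ "r + of_int m"]) auto
qed

section \<open>Behaviour at the cusp and the maximum of F\<close>

lemma F_holomorphic: "F holomorphic_on {z. Im z > 0}"
proof -
  have f7: "(\<lambda>z. f (7 * z)) holomorphic_on {z. Im z > 0}"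
    by (rule holomorphic_on_compose_gen[OF _ hol, unfolded o_def]) (auto intro!: holomorphic_intros)
  have "vertex_form (f z) * vertex_form (f (7 * z)) \<noteq> 0" if "Im z > 0" for z
    using vertex_form_nonzero[of z] vertex_form_nonzero[of "7 * z"] that by simp
  thus ?thesis
    unfolding F_def cubic7_ratio_def cubic7_poly_def
    by (auto simp: vertex_form_def intro!: holomorphic_intros hol f7)
qed

lemma F_cusp: "(F \<longlongrightarrow> 0) (filtercomap Im at_top)"
proof -
  let ?L = "filtercomap Im at_top"
  define r where "r = (\<lambda>z. f z ^ 7 / f (7 * z))"
  \<comment> \<open>Equals \<open>f (7 * z)\<close> on the half plane; in this form its limit 0
    follows from those of \<open>f\<close> and \<open>r\<close>.\<close>
  define v where "v = (\<lambda>z. f z ^ 7 / r z)"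
  \<comment> \<open>\<open>F\<close> with numerator and denominator divided by \<open>u * v\<close>.
    The critical terms \<open>u^8 - u * v\<close> become \<open>r - 1\<close>, and
    \<open>v^7 / u\<close> is written as \<open>v^6 * (u^6 / r)\<close> to avoid dividing by
    something that tends to 0.\<close>
  define G where "G = (\<lambda>z. (r z - 1 + 7 * f z^3 + 28 * f z^5 * v z - 56 * f z^4 * v z^2 + 7 * v z^3
     + 21 * f z^3 * v z^3 - 56 * f z^6 * v z^3 - 56 * f z^2 * v z^4 + 28 * f z * v z^5 - 56 * f z^3 * v z^6
     - 64 * f z^6 * v z^6 + v z^6 * (f z^6 / r z))
     / ((1 + f z^3) * (1 - 8 * f z^3) * ((1 + v z^3) * (1 - 8 * v z^3))))"
  have r: "(r \<longlongrightarrow> 1) ?L"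
    using cusp_ratio by (simp add: r_def)
  have v: "(v \<longlongrightarrow> 0) ?L"
    unfolding v_def by (rule tendsto_eq_intros cusp_zero r | simp)+
  have "(G \<longlongrightarrow> 0) ?L"
    unfolding G_def by (rule tendsto_eq_intros cusp_zero r v | simp)+
  moreover have "eventually (\<lambda>z. G z = F z) ?L"
  proof -
    have "eventually (\<lambda>z. Im z > 0) ?L"
      by (intro eventually_filtercomapI eventually_gt_at_top)
    thus ?thesis
    proof eventually_elim
      case (elim z)
      define a b where "a = f z" and "b = f (7 * z)"
      have ab: "a \<noteq> 0" "b \<noteq> 0"
        using elim nonzero by (auto simp: a_def b_def)
      have vz: "v z = b" and rz: "r z = a ^ 7 / b"
        using ab by (simp_all add: v_def r_def a_def b_def)
      have "(a ^ 7 / b - 1 + 7 * a^3 + 28 * a^5 * b - 56 * a^4 * b^2 + 7 * b^3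
     + 21 * a^3 * b^3 - 56 * a^6 * b^3 - 56 * a^2 * b^4 + 28 * a * b^5 - 56 * a^3 * b^6
     - 64 * a^6 * b^6 + b^6 * (a^6 / (a ^ 7 / b))) * (a * b) = cubic7_poly a b"
        unfolding cubic7_poly_def using ab
        by (simp add: field_simps) (simp add: power_numeral_reduce)
      hence num: "(a ^ 7 / b - 1 + 7 * a^3 + 28 * a^5 * b - 56 * a^4 * b^2 + 7 * b^3
     + 21 * a^3 * b^3 - 56 * a^6 * b^3 - 56 * a^2 * b^4 + 28 * a * b^5 - 56 * a^3 * b^6
     - 64 * a^6 * b^6 + b^6 * (a^6 / (a ^ 7 / b))) = cubic7_poly a b / (a * b)"
        using ab by (simp add: eq_divide_eq)
      show ?case
        unfolding G_def F_def vz rz a_def[symmetric] b_def[symmetric] num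
        by (simp add: cubic7_ratio_def vertex_form_def mult_ac)
    qed
  qed
  ultimately show ?thesis
    by (rule Lim_transform_eventually)
qed

theorem F_zero:
  assumes "Im t > 0"
  shows "F t = 0"
proof (rule ccontr)
  assume nz: "F t \<noteq> 0"
  let ?H = "{z. Im z > 0}"
  have "eventually (\<lambda>z. norm (F z) < norm (F t)) (filtercomap Im at_top)"
    using F_cusp nz by (auto simp: tendsto_iff)
  then obtain Y where Y: "\<And>z. Im z \<ge> Y \<Longrightarrow> norm (F z) < norm (F t)"
    by (auto simp: eventually_filtercomap eventually_at_top_linorder)
  define K where "K = cbox (Complex (-1/2) (9/140)) (Complex (1/2) (max Y 1))"
  have K: "z \<in> K \<longleftrightarrow> \<bar>Re z\<bar> \<le> 1/2 \<and> 9/140 \<le> Im z \<and> Im z \<le> max Y 1" for z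
    by (auto simp: K_def cbox_def Basis_complex_def)
  have "K \<subseteq> ?H"
    using K by auto
  hence cont: "continuous_on K (\<lambda>z. norm (F z))"
    by (intro continuous_intros holomorphic_on_imp_continuous_on[OF holomorphic_on_subset[OF F_holomorphic]])
  \<comment> \<open>Values at least as large in norm as \<open>F t\<close> cannot be attained above
    \<open>Y\<close>, so reduction lands in the compact \<open>K\<close>. Hence a maximum over
    \<open>K\<close> is one over the half plane.\<close>
  have red: "\<exists>s\<in>K. F z = F s" if "Im z > 0" "norm (F z) \<ge> norm (F t)" for z
  proof -
    from F_reduce[OF that(1)] obtain s where s: "Im s \<ge> 9/140" "\<bar>Re s\<bar> \<le> 1/2" "F z = F s"
      by blast
    have "Im s \<le> Y"
      by (rule ccontr) (use Y[of s] that s in auto)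
    with s show ?thesis
      by (intro bexI[of _ s]) (auto simp: K)
  qed
  from red[OF assms] have "K \<noteq> {}" by auto
  moreover have "compact K"
    by (simp add: K_def)
  ultimately obtain s where s: "s \<in> K" "\<And>z. z \<in> K \<Longrightarrow> norm (F z) \<le> norm (F s)"
    using continuous_attains_sup[OF _ _ cont] by blast
  have st: "norm (F t) \<le> norm (F s)"
    using red[OF assms] s(2) by auto
  have max: "norm (F z) \<le> norm (F s)" if "z \<in> ?H" for z
    using red[of z] s(2) st that by (cases "norm (F z) \<ge> norm (F t)") auto
  have "F constant_on ?H"
    by (rule maximum_modulus_principle[OF F_holomorphic, of ?H s])
       (use s(1) \<open>K \<subseteq> ?H\<close> max in \<open>auto simp: open_halfspace_Im_gt intro: convex_connected convex_halfspace_Im_gt\<close>)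
  then obtain c where c: "\<And>z. Im z > 0 \<Longrightarrow> F z = c"
    by (auto simp: constant_on_def)
  have "F (Complex 0 (max Y 1)) = c" "F t = c"
    using c assms by auto
  thus False
    using Y[of "Complex 0 (max Y 1)"] by auto
qed

corollary cubic7_equation:
  assumes "Im t > 0"
  shows "cubic7_poly (f t) (f (7 * t)) = 0"
  using F_zero[OF assms] vertex_form_nonzero[of t] vertex_form_nonzero[of "7 * t"] assms
  by (simp add: F_def cubic7_ratio_def)

end

section \<open>The continued fraction on the upper half plane\<close>

text \<open>Taken as a function of the nome in the unit disc, so that the cusp becomes the interior
  point 0, where continuity supplies the limits.\<close>

definition eprod :: "nat \<Rightarrow> complex \<Rightarrow> complex" where
  "eprod k w = (\<Prod>n. 1 - w ^ (6 * n + k))"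

lemma norm_power_6_le:
  fixes w :: complex
  assumes "norm w \<le> r" "r \<le> 1"
  shows "norm (w ^ (6 * n + k)) \<le> r ^ n"
proof -
  have "norm (w ^ (6 * n + k)) \<le> r ^ (6 * n + k)"
    using assms(1) by (simp add: norm_power power_mono)
  also have "\<dots> \<le> r ^ n"
    using assms norm_ge_zero[of w] by (intro power_decreasing) (auto simp del: norm_ge_zero)
  finally show ?thesis .
qed

lemma eprod_convergent:
  fixes w :: complex
  assumes "norm w < 1"
  shows "convergent_prod (\<lambda>n. 1 - w ^ (6 * n + k))"
proof -
  have "summable (\<lambda>n. norm (1 - w ^ (6 * n + k) - 1))"
    by (rule summable_comparison_test'[of "\<lambda>n. norm w ^ n" 0])
       (use norm_power_6_le[of w "norm w"] assms in \<open>auto intro: summable_geometric\<close>)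
  from abs_convergent_prod_imp_convergent_prod[OF summable_imp_abs_convergent_prod[OF this]]
  show ?thesis .
qed

lemma eprod_nonzero:
  assumes "norm w < 1" "k > 0"
  shows "eprod k w \<noteq> 0"
  unfolding eprod_def
proof (rule prodinf_nonzero[OF eprod_convergent[OF assms(1)]])
  fix n
  have "norm (w ^ (6 * n + k)) < 1"
    using assms by (simp add: norm_power power_less_one_iff)
  thus "1 - w ^ (6 * n + k) \<noteq> 0"
    by auto
qed

lemma eprod_0: "k > 0 \<Longrightarrow> eprod k 0 = 1"
  by (simp add: eprod_def power_0_left)

lemma eprod_of_real:
  assumes "0 < q" "q < 1"
  shows "eprod k (of_real q) = of_real (\<Prod>n. 1 - q ^ (6 * n + k))"
proof -
  have "convergent_prod (\<lambda>n. 1 - q ^ (6 * n + k))"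
    using convergent_prod_linear_power(2)[OF assms, of 6 1 k] by simp
  hence "(\<lambda>n. 1 - q ^ (6 * n + k)) has_prod (\<Prod>n. 1 - q ^ (6 * n + k))"
    by blast
  hence "(\<lambda>n. complex_of_real (1 - q ^ (6 * n + k))) has_prod of_real (\<Prod>n. 1 - q ^ (6 * n + k))"
    by (subst has_prod_of_real_iff)
  thus ?thesis
    by (simp add: eprod_def has_prod_iff)
qed

lemma eprod_holomorphic: "eprod k holomorphic_on ball 0 1"
proof (rule holomorphic_uniform_sequence)
  show "(\<lambda>w. \<Prod>n<N. 1 - w ^ (6 * n + k)) holomorphic_on ball 0 1" for N
    by (intro holomorphic_intros)
  fix w :: complex assume w: "w \<in> ball 0 1"
  define r where "r = (1 + norm w) / 2"
  have r: "norm w < r" "r < 1" "r \<ge> 0"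
    using w by (auto simp: r_def)
  have "uniformly_convergent_on (cball 0 r) (\<lambda>N w. \<Prod>n<N. 1 - w ^ (6 * n + k) :: complex)"
  proof (rule uniformly_convergent_on_prod')
    show "uniformly_convergent_on (cball 0 r) (\<lambda>N w. \<Sum>n<N. norm (1 - w ^ (6 * n + k) - 1 :: complex))"
      by (rule Weierstrass_m_test'[of _ _ "\<lambda>n. r ^ n"])
         (use norm_power_6_le[of _ r] r in \<open>auto intro: summable_geometric\<close>)
  qed (auto intro!: continuous_intros)
  then obtain l where l: "uniform_limit (cball 0 r) (\<lambda>N w. \<Prod>n<N. 1 - w ^ (6 * n + k) :: complex) l sequentially"
    by (auto simp: uniformly_convergent_on_def)
  have "l z = eprod k z" if "z \<in> cball 0 r" for z
  proof (rule LIMSEQ_unique)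
    show "(\<lambda>N. \<Prod>n<N. 1 - z ^ (6 * n + k)) \<longlonglongrightarrow> l z"
      using tendsto_uniform_limitI[OF l that] .
    show "(\<lambda>N. \<Prod>n<N. 1 - z ^ (6 * n + k)) \<longlonglongrightarrow> eprod k z"
      using convergent_prod_LIMSEQ[OF eprod_convergent[of z k]] that r
      by (simp add: eprod_def LIMSEQ_lessThan_iff_atMost)
  qed
  hence "uniform_limit (cball 0 r) (\<lambda>N w. \<Prod>n<N. 1 - w ^ (6 * n + k)) (eprod k) sequentially"
    using l by (subst uniform_limit_cong'[OF refl, of _ _ l]) simp_all
  moreover have "cball w (r - norm w) \<subseteq> cball 0 r"
    by (simp add: cball_subset_cball_iff)
  ultimately have "uniform_limit (cball w (r - norm w)) (\<lambda>N w. \<Prod>n<N. 1 - w ^ (6 * n + k)) (eprod k) sequentially"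
    by (rule uniform_limit_on_subset)
  moreover have "cball w (r - norm w) \<subseteq> ball 0 1"
    using \<open>cball w (r - norm w) \<subseteq> cball 0 r\<close> r by auto
  ultimately show "\<exists>d>0. cball w d \<subseteq> ball 0 1 \<and>
      uniform_limit (cball w d) (\<lambda>N w. \<Prod>n<N. 1 - w ^ (6 * n + k)) (eprod k) sequentially"
    using r by (intro exI[of _ "r - norm w"]) auto
qed auto

definition cubic_eta :: "complex \<Rightarrow> complex" where
  "cubic_eta w = eprod 1 w * eprod 5 w / (eprod 3 w)\<^sup>2"

text \<open>\<open>exp (2 * pi * \<i> * z / 3)\<close> is a single-valued choice of the cube root of
  the nome; it alone causes the factor picked up under translation by 1.\<close>

definition cubic_V :: "complex \<Rightarrow> complex" where
  "cubic_V z = exp (2 * pi * \<i> * z / 3) * cubic_eta (exp (2 * pi * \<i> * z))"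

lemma cubic_eta_holomorphic: "cubic_eta holomorphic_on ball 0 1"
  unfolding cubic_eta_def by (intro holomorphic_intros eprod_holomorphic) (auto simp: eprod_nonzero)

lemma cubic_eta_nonzero: "norm w < 1 \<Longrightarrow> cubic_eta w \<noteq> 0"
  by (simp add: cubic_eta_def eprod_nonzero)

lemma norm_nome: "norm (exp (2 * pi * \<i> * z)) = exp (- 2 * pi * Im z)"
  by (simp add: norm_exp_eq_Re)

lemma norm_nome_less_1: "Im z > 0 \<Longrightarrow> norm (exp (2 * pi * \<i> * z)) < 1"
  unfolding norm_nome by (simp add: mult_pos_pos)

lemma cubic_V_imaginary_axis:
  assumes "t > 0"
  shows "cubic_V (\<i> * of_real t) = of_real (cubic_cf (exp (- 2 * pi * t)))"
proof -
  define q where "q = exp (- 2 * pi * t)"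
  have q: "0 < q" "q < 1"
    using assms by (simp_all add: q_def)
  have "2 * pi * \<i> * (\<i> * of_real t) = of_real (- 2 * pi * t)"
       "2 * pi * \<i> * (\<i> * of_real t) / 3 = of_real (- 2 * pi * t / 3)"
    by (simp_all add: algebra_simps)
  hence e: "exp (2 * pi * \<i> * (\<i> * of_real t)) = of_real q"
      "exp (2 * pi * \<i> * (\<i> * of_real t) / 3) = of_real (q powr (1 / 3))"
    by (simp_all only: exp_of_real q_def) (simp_all add: powr_def)
  show ?thesis
    unfolding cubic_V_def e cubic_eta_def eprod_of_real[OF q] q_def[symmetric] cubic_cf_prodinf[OF q]
    by simp
qed

lemma cubic_V_holomorphic: "cubic_V holomorphic_on {z. Im z > 0}"
proof -
  have "(\<lambda>z. cubic_eta (exp (2 * pi * \<i> * z))) holomorphic_on {z. Im z > 0}"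
    by (rule holomorphic_on_compose_gen[OF _ cubic_eta_holomorphic, unfolded o_def])
       (use norm_nome_less_1 in \<open>auto intro!: holomorphic_intros\<close>)
  thus ?thesis
    unfolding cubic_V_def by (intro holomorphic_intros) auto
qed

text \<open>By the identity theorem: the difference of the two sides is holomorphic and vanishes on
  the positive imaginary axis, which the inversion maps to itself by \<open>t\<close> to
  \<open>1 / (2 * t)\<close>, so that \<open>cubic_cf_inversion\<close> applies.\<close>

lemma cubic_V_inversion:
  assumes "Im z > 0"
  shows "(1 - 2 * cubic_V (fricke z)) * (1 + cubic_V z) = 3 * cubic_V z"
proof -
  let ?H = "{z. Im z > 0}"
  define G where "G = (\<lambda>z. (1 - 2 * cubic_V (fricke z)) * (1 + cubic_V z) - 3 * cubic_V z)"
  define U where "U = (\<lambda>t. \<i> * complex_of_real t) ` {0<..}"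
  have "G z = 0"
  proof (rule analytic_continuation[of G ?H U \<i>])
    have "fricke holomorphic_on ?H"
      unfolding fricke_def by (intro holomorphic_intros) auto
    hence "(\<lambda>z. cubic_V (fricke z)) holomorphic_on ?H"
      by (rule holomorphic_on_compose_gen[OF _ cubic_V_holomorphic, unfolded o_def]) auto
    thus "G holomorphic_on ?H"
      unfolding G_def by (intro holomorphic_intros cubic_V_holomorphic)
    show "open ?H"
      by (rule open_halfspace_Im_gt)
    show "connected ?H"
      by (intro convex_connected convex_halfspace_Im_gt)
    show "U \<subseteq> ?H" "\<i> \<in> ?H" "z \<in> ?H"
      using assms by (auto simp: U_def)
    \<comment> \<open>A connected set with more than one point has no isolated points.\<close>
    show "\<i> islimpt U"
    proof (rule connected_imp_perfect)
      show "connected U"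
        unfolding U_def by (intro connected_continuous_image continuous_intros) auto
      show "\<i> \<in> U"
        unfolding U_def by (intro image_eqI[of _ _ 1]) auto
      have "\<i> * of_real 2 \<in> U"
        unfolding U_def by (intro image_eqI[of _ _ 2]) auto
      moreover have "\<i> * of_real 2 \<noteq> \<i>" by simp
      ultimately show "U \<noteq> {x}" for x
        using \<open>\<i> \<in> U\<close> by (metis singletonD)
    qed
    fix y assume "y \<in> U"
    then obtain t where t: "t > 0" "y = \<i> * of_real t"
      by (auto simp: U_def)
    have "fricke y = \<i> * of_real (1 / (2 * t))"
      using t by (simp add: fricke_def field_simps)
    hence "cubic_V (fricke y) = of_real (cubic_cf (exp (- 2 * pi * (1 / (2 * t)))))"
      using t cubic_V_imaginary_axis[of "1 / (2 * t)"] by simp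
    also have "- 2 * pi * (1 / (2 * t)) = - pi / t"
      by simp
    finally have "G y = of_real ((1 - 2 * cubic_cf (exp (- pi / t))) * (1 + cubic_cf (exp (- 2 * pi * t)))
         - 3 * cubic_cf (exp (- 2 * pi * t)))"
      using cubic_V_imaginary_axis[OF t(1)] by (simp add: G_def t(2))
    thus "G y = 0"
      by (simp only: cubic_cf_inversion[OF t(1)] diff_self of_real_0)
  qed
  thus ?thesis by (simp add: G_def)
qed

lemma nome_tendsto_0: "c > 0 \<Longrightarrow> ((\<lambda>z. exp (of_real c * \<i> * z)) \<longlongrightarrow> 0) (filtercomap Im at_top)"
proof (rule tendsto_norm_zero_cancel)
  assume c: "c > 0"
  have "((\<lambda>y. exp (- (c * y))) \<longlongrightarrow> 0) at_top"
    using c by (intro filterlim_compose[OF exp_at_bot] filterlim_uminus_at_bot_at_top[THEN filterlim_compose]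
        filterlim_tendsto_pos_mult_at_top[OF tendsto_const] filterlim_ident)
  hence "((\<lambda>z. exp (- (c * Im z))) \<longlongrightarrow> 0) (filtercomap Im at_top)"
    by (rule filterlim_compose) (rule filterlim_filtercomap)
  thus "((\<lambda>z. norm (exp (of_real c * \<i> * z))) \<longlongrightarrow> 0) (filtercomap Im at_top)"
    by (simp add: norm_exp_eq_Re)
qed

lemma cubic_eta_tendsto:
  assumes "(g \<longlongrightarrow> 0) F" shows "((\<lambda>z. cubic_eta (g z)) \<longlongrightarrow> 1) F"
proof -
  have "isCont cubic_eta 0"
    using cubic_eta_holomorphic by (auto simp: continuous_on_eq_continuous_at dest!: holomorphic_on_imp_continuous_on)
  hence "((\<lambda>z. cubic_eta (g z)) \<longlongrightarrow> cubic_eta 0) F"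
    using assms isCont_tendsto_compose by blast
  thus ?thesis by (simp add: cubic_eta_def eprod_0)
qed

interpretation V: cubic_modular cubic_V "exp (2 * pi * \<i> / 3)"
proof
  let ?w = "exp (2 * pi * \<i> / 3)"
  show "cubic_V holomorphic_on {z. Im z > 0}"
    by (rule cubic_V_holomorphic)
  show "cubic_V z \<noteq> 0" if "Im z > 0" for z
    using cubic_eta_nonzero[OF norm_nome_less_1[OF that]] by (simp add: cubic_V_def)
  have period: "exp (2 * pi * \<i>) = 1"
  proof -
    have "2 * pi * \<i> = 2 * of_real pi * \<i>"
      by simp
    thus ?thesis
      by (simp only: exp_two_pi_i)
  qed
  have "?w ^ 3 = exp (of_nat 3 * (2 * pi * \<i> / 3))"
    by (rule exp_of_nat_mult[symmetric])
  also have "of_nat 3 * (2 * pi * \<i> / 3) = 2 * pi * \<i>"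
    by simp
  finally show "?w ^ 3 = 1" by (simp only: period)
  show "?w \<noteq> 1"
  proof
    assume "?w = 1"
    then obtain n :: int where "2 * pi / 3 = of_int (2 * n) * pi"
      by (auto simp: exp_eq_1)
    hence "3 * n = 1"
      by (simp add: field_simps) linarith?
    thus False by presburger
  qed
  show "cubic_V (z + 1) = ?w * cubic_V z" if "Im z > 0" for z
  proof -
    have "exp (2 * pi * \<i> * (z + 1)) = exp (2 * pi * \<i> * z)"
      by (simp only: distrib_left exp_add mult_1_right period)
    moreover have "exp (2 * pi * \<i> * (z + 1) / 3) = ?w * exp (2 * pi * \<i> * z / 3)"
      by (simp add: distrib_left exp_add add_divide_distrib)
    ultimately show ?thesis
      by (simp add: cubic_V_def)
  qed
  show "(1 - 2 * cubic_V (fricke z)) * (1 + cubic_V z) = 3 * cubic_V z" if "Im z > 0" for z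
    by (rule cubic_V_inversion[OF that])
  have nome: "((\<lambda>z. exp (2 * pi * \<i> * z)) \<longlongrightarrow> 0) (filtercomap Im at_top)"
    using nome_tendsto_0[of "2 * pi"] by simp
  have "((\<lambda>z. exp (2 * pi * \<i> * z / 3)) \<longlongrightarrow> 0) (filtercomap Im at_top)"
    using nome_tendsto_0[of "2 * pi / 3"] by simp
  hence "(cubic_V \<longlongrightarrow> 0 * 1) (filtercomap Im at_top)"
    unfolding cubic_V_def by (intro tendsto_mult cubic_eta_tendsto nome)
  thus "(cubic_V \<longlongrightarrow> 0) (filtercomap Im at_top)" by simp
  have nome7: "((\<lambda>z. exp (2 * pi * \<i> * (7 * z))) \<longlongrightarrow> 0) (filtercomap Im at_top)"
    using nome_tendsto_0[of "14 * pi"] by (simp add: mult_ac)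
  \<comment> \<open>The fractional powers of the nome cancel exactly, leaving a quotient of
    functions equal to 1 at nome 0.\<close>
  have "cubic_V z ^ 7 / cubic_V (7 * z) = cubic_eta (exp (2 * pi * \<i> * z)) ^ 7 / cubic_eta (exp (2 * pi * \<i> * (7 * z)))" for z
  proof -
    have "exp (2 * pi * \<i> * z / 3) ^ 7 = exp (2 * pi * \<i> * (7 * z) / 3)"
      by (simp add: exp_of_nat_mult[symmetric] mult_ac)
    thus ?thesis
      by (simp add: cubic_V_def power_mult_distrib)
  qed
  moreover have "((\<lambda>z. cubic_eta (exp (2 * pi * \<i> * z)) ^ 7 / cubic_eta (exp (2 * pi * \<i> * (7 * z)))) \<longlongrightarrow> 1 ^ 7 / 1)
      (filtercomap Im at_top)"
    by (intro tendsto_intros cubic_eta_tendsto nome nome7) auto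
  ultimately show "((\<lambda>z. cubic_V z ^ 7 / cubic_V (7 * z)) \<longlongrightarrow> 1) (filtercomap Im at_top)"
    by simp
qed

theorem mainTheorem5:
  fixes q u v :: real
  assumes "0 < q" and "q < 1"
    and "u = cubic_cf q" and "v = cubic_cf (q ^ 7)"
  shows "u^8 - u * v + 7 * u^4 * v + 28 * u^6 * v^2 - 56 * u^5 * v^3 + 7 * u * v^4 + 21 * u^4 * v^4
           - 56 * u^7 * v^4 - 56 * u^3 * v^5 + 28 * u^2 * v^6 - 56 * u^4 * v^7 - 64 * u^7 * v^7 + v^8 = 0"
proof -
  \<comment> \<open>Chosen so that \<open>q\<close> is the nome of \<open>\<i> * t\<close>;
    multiplying the point by 7 then raises the nome to \<open>q ^ 7\<close>.\<close>
  define t where "t = - ln q / (2 * pi)"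
  have t: "t > 0"
    using assms(1,2) by (simp add: t_def divide_neg_pos)
  have q: "exp (- 2 * pi * t) = q"
    using assms(1) by (simp add: t_def)
  have "exp (- 2 * pi * (7 * t)) = exp (- 2 * pi * t) ^ 7"
    by (simp add: exp_of_nat_mult[symmetric] mult_ac)
  hence q7: "exp (- 2 * pi * (7 * t)) = q ^ 7"
    by (simp only: q)
  have u: "cubic_V (\<i> * of_real t) = of_real u"
    using cubic_V_imaginary_axis[OF t] q assms(3) by simp
  have "cubic_V (\<i> * of_real (7 * t)) = of_real v"
    using cubic_V_imaginary_axis[of "7 * t"] t q7 assms(4) by simp
  moreover have "\<i> * of_real (7 * t) = 7 * (\<i> * of_real t)"
    by simp
  ultimately have v: "cubic_V (7 * (\<i> * of_real t)) = of_real v"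
    by (simp only:)
  have "cubic7_poly (complex_of_real u) (of_real v) = 0"
    using V.cubic7_equation[of "\<i> * of_real t"] t unfolding u v by simp
  moreover have "cubic7_poly (complex_of_real u) (of_real v) = of_real (cubic7_poly u v)"
    by (simp add: cubic7_poly_def)
  ultimately have "cubic7_poly u v = 0"
    by (simp only: of_real_eq_0_iff)
  thus ?thesis
    unfolding cubic7_poly_def .
qed

end
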